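(* Let $\{X_n, n\ge1\}$ be a strictly stationary and ergodic sequence of random variables with common distribution function $F$. Let $h:\mathbb{R}\to\mathbb{R}$ be measurable, and for each $n$ let $c_{n1},\dots,c_{nn}$ be real constants. Define $$L_n=\frac1n\sum_{i=1}^n c_{ni}\,h(X_{n:i}),$$ where $X_{n:1}\le\dots\le X_{n:n}$ are the order statistics of $X_1,\dots,X_n$. Let $F^{-1}(t)=\inf\{x:F(x)\ge t\}$, $H(t)=h(F^{-1}(t))$, let $c_n(t)=c_{ni}$ for $t\in((i-1)/n,i/n]$, $i=1,\dots,n$, $c_n(0)=c_{n1}$, and $$\mu_n=\int_0^1 c_n(t)H(t)\,dt .$$ For $1\le q<\infty$ put $C_n(q)=n^{-1}\sum_{i=1}^n|c_{ni}|^q$, and $C_n(\infty)=\max_{i\le n}|c_{ni}|$. Suppose that one of the following conditions holds: (i) $H$ is continuous on $[0,1]$ and $\sup_{n\ge1}C_n(1)<\infty$; (ii) for some $1\le p<\infty$, $\mathbf{E}|h(X_1)|^p<\infty$ and $\sup_{n\ge1}C_n(q)<\infty$, where $1/p+1/q=1$ (so $q=\infty$ when $p=1$). Then $L_n-\mu_n\to0$ almost surely as $n\to\infty$.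
   Context: In condition (i), "$H$ is continuous on $[0,1]$" means that $H$ (defined by $h(F^{-1}(t))$ for $t\in(0,1)$) is, or extends to, a continuous function on the closed interval $[0,1]$. *)

theory Defs
  imports "HOL-Probability.Probability"
begin

text \<open>The sequence X_1, X_2, ... of the paper is X 0, X 1, ... here (X_i = X (i-1)).\<close>

definition strictly_stationary :: "'a measure \<Rightarrow> (nat \<Rightarrow> 'a \<Rightarrow> real) \<Rightarrow> bool" where
  "strictly_stationary M X \<longleftrightarrow>
     (\<forall>k n. distr M (PiM {..<n} (\<lambda>_. borel)) (\<lambda>\<omega>. \<lambda>i\<in>{..<n}. X (i + k) \<omega>)
          = distr M (PiM {..<n} (\<lambda>_. borel)) (\<lambda>\<omega>. \<lambda>i\<in>{..<n}. X i \<omega>))"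

definition seq_shift :: "(nat \<Rightarrow> real) \<Rightarrow> (nat \<Rightarrow> real)" where
  "seq_shift f = (\<lambda>i. f (Suc i))"

definition ergodic_seq :: "'a measure \<Rightarrow> (nat \<Rightarrow> 'a \<Rightarrow> real) \<Rightarrow> bool" where
  "ergodic_seq M X \<longleftrightarrow>
     (\<forall>B \<in> sets (PiM (UNIV::nat set) (\<lambda>_. (borel :: real measure))).
        seq_shift -` B \<inter> space (PiM (UNIV::nat set) (\<lambda>_. (borel :: real measure))) = B \<longrightarrow>
        measure M {\<omega> \<in> space M. (\<lambda>i. X i \<omega>) \<in> B} \<in> {0, 1})"

definition order_stat :: "(nat \<Rightarrow> 'a \<Rightarrow> real) \<Rightarrow> nat \<Rightarrow> nat \<Rightarrow> 'a \<Rightarrow> real" where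
  "order_stat X n i \<omega> = sort (map (\<lambda>j. X j \<omega>) [0..<n]) ! (i - 1)"

definition L_stat :: "(nat \<Rightarrow> nat \<Rightarrow> real) \<Rightarrow> (real \<Rightarrow> real) \<Rightarrow> (nat \<Rightarrow> 'a \<Rightarrow> real) \<Rightarrow> nat \<Rightarrow> 'a \<Rightarrow> real" where
  "L_stat c h X n \<omega> = (1 / real n) * (\<Sum>i=1..n. c n i * h (order_stat X n i \<omega>))"

definition distr_fun :: "'a measure \<Rightarrow> ('a \<Rightarrow> real) \<Rightarrow> real \<Rightarrow> real" where
  "distr_fun M Y x = measure M {\<omega> \<in> space M. Y \<omega> \<le> x}"

definition quantile :: "(real \<Rightarrow> real) \<Rightarrow> real \<Rightarrow> real" where
  "quantile F t = Inf {x. F x \<ge> t}"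

text \<open>c_n(t) = c_{ni} for t in ((i-1)/n, i/n], c_n(0) = c_{n1}.\<close>
definition step_coef :: "(nat \<Rightarrow> nat \<Rightarrow> real) \<Rightarrow> nat \<Rightarrow> real \<Rightarrow> real" where
  "step_coef c n t = (if t \<le> 0 then c n 1 else c n (nat \<lceil>real n * t\<rceil>))"

definition Cq :: "(nat \<Rightarrow> nat \<Rightarrow> real) \<Rightarrow> nat \<Rightarrow> real \<Rightarrow> real" where
  "Cq c n q = (1 / real n) * (\<Sum>i=1..n. \<bar>c n i\<bar> powr q)"

definition Cinf :: "(nat \<Rightarrow> nat \<Rightarrow> real) \<Rightarrow> nat \<Rightarrow> real" where
  "Cinf c n = Max ((\<lambda>i. \<bar>c n i\<bar>) ` {1..n})"

end

theory Submission
  imports Defs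
begin

text \<open>The difference between the L-statistic and its centring is the integral over (0,1) of c_n times
  h(F_n^{-1}) - h(F^{-1}), where F_n is the empirical distribution function. Under (ii) it suffices,
  by Young's inequality with a small weight on the coefficients, that h(F_n^{-1}) tends to h(F^{-1}) almost surely in Lp(0,1). For the indicator
  of a half-line this is convergence of F_n at one point; a pi-lambda argument passes to
  Borel sets and approximation in Lp to general h, since by Birkhoff's ergodic theorem the Lp norm
  at the sample converges to that under the law. Under (i) one needs uniform convergence: up to a null set
  h(x) = G(s) for every s between F(x-) and F(x), and by a Glivenko--Cantelli argument the point
  x = F_n^{-1}(t) has such an s close to t, so uniform continuity of G applies.\<close>

subsection \<open>Birkhoff's ergodic theorem\<close>

text \<open>Under (ii) \<open>h\<close> is merely measurable, so nearness of the two quantiles at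
  some t says nothing about nearness of the values of \<open>h\<close> there; convergence has to be
  built up from sets, and in an integrated sense. The exceptional null set depends on the function
  under study, so only countably many approximants may ever be combined. Under (i) the coefficients
  are bounded only in L1, and this forces a sup-norm estimate on the other factor. Continuity of H
  leaves \<open>h\<close> arbitrary at points that the quantile function never takes on (0,1); this
  is why h(x) can be tied to G only up to a null set of sample points.\<close>

locale ergodic_map = prob_space N for N :: "'b measure" +
  fixes T :: "'b \<Rightarrow> 'b"
  assumes measurable_T [measurable]: "T \<in> measurable N N"
    and preserves: "distr N N T = N"
    and ergodic: "\<And>A. A \<in> sets N \<Longrightarrow> T -` A \<inter> space N = A \<Longrightarrow> prob A \<in> {0, 1}"
begin

definition birkhoff_sum :: "('b \<Rightarrow> real) \<Rightarrow> nat \<Rightarrow> 'b \<Rightarrow> real" where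
  "birkhoff_sum f n x = (\<Sum>i<n. f ((T ^^ i) x))"

text \<open>Equals the maximum of the Birkhoff sums of lengths 0 to n.\<close>

primrec birkhoff_max :: "('b \<Rightarrow> real) \<Rightarrow> nat \<Rightarrow> 'b \<Rightarrow> real" where
  "birkhoff_max f 0 x = 0"
| "birkhoff_max f (Suc n) x = max 0 (f x + birkhoff_max f n (T x))"

lemma T_space: "x \<in> space N \<Longrightarrow> T x \<in> space N"
  by (rule measurable_space[OF measurable_T])

lemma birkhoff_sum_Suc: "birkhoff_sum f (Suc n) x = f x + birkhoff_sum f n (T x)"
  unfolding birkhoff_sum_def by (simp add: sum.lessThan_Suc_shift funpow_swap1 del: sum.lessThan_Suc)

lemma birkhoff_sum_le_max: "birkhoff_sum f n x \<le> birkhoff_max f n x"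
proof (induction n arbitrary: x)
  case (Suc n)
  then show ?case by (simp add: birkhoff_sum_Suc le_max_iff_disj)
qed (simp add: birkhoff_sum_def)

lemma birkhoff_max_nonneg: "0 \<le> birkhoff_max f n x"
  by (cases n) auto

lemma birkhoff_max_mono_Suc: "birkhoff_max f n x \<le> birkhoff_max f (Suc n) x"
proof (induction n arbitrary: x)
  case (Suc n)
  from Suc[of "T x"] show ?case
    unfolding birkhoff_max.simps(2)[of f n] birkhoff_max.simps(2)[of f "Suc n"] by linarith
qed simp

lemma birkhoff_max_mono: "m \<le> n \<Longrightarrow> birkhoff_max f m x \<le> birkhoff_max f n x"
  by (rule lift_Suc_mono_le[of "\<lambda>n. birkhoff_max f n x"]) (rule birkhoff_max_mono_Suc)

lemma integrable_comp_T:
  fixes f :: "'b \<Rightarrow> real"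
  assumes "integrable N f"
  shows "integrable N (\<lambda>x. f (T x))"
  using integrable_distr[OF measurable_T, of f] assms by (simp add: preserves)

lemma integral_comp_T:
  fixes f :: "'b \<Rightarrow> real"
  assumes [measurable]: "f \<in> borel_measurable N"
  shows "(LINT x|N. f (T x)) = (LINT x|N. f x)"
  using integral_distr[OF measurable_T, of f] by (simp add: preserves)

lemma integrable_birkhoff_max:
  assumes "integrable N f"
  shows "integrable N (birkhoff_max f n)"
proof (induction n)
  case (Suc n)
  then show ?case using assms
    by (auto simp: fun_eq_iff intro!: integrable_max integrable_comp_T[of "birkhoff_max f n"]
      cong: integrable_cong)
qed (simp add: fun_eq_iff cong: integrable_cong)

text \<open>The one-sided core of the ergodic theorem, by a maximal-function argument in the style
  of Garsia. Sums bounded above have averages with limsup at most 0; a general function is shifted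
  so that its mean becomes negative.\<close>

lemma birkhoff_sum_bounded_above:
  assumes f [measurable]: "integrable N f" and neg: "(LINT x|N. f x) < 0"
  shows "AE x in N. \<exists>B. \<forall>n. birkhoff_sum f n x \<le> B"
proof -
  let ?m = "birkhoff_max f"
  have m_int: "integrable N (?m n)" for n by (rule integrable_birkhoff_max[OF f])
  have [measurable]: "?m n \<in> borel_measurable N" for n by (rule borel_measurable_integrable[OF m_int])
  define A where "A = {x \<in> space N. \<forall>B::nat. \<exists>n. ?m n x > real B}"
  have A_sets [measurable]: "A \<in> sets N" unfolding A_def by measurable
  have inA: "x \<in> A \<longleftrightarrow> (\<forall>B. \<exists>n. ?m n x > B)" if "x \<in> space N" for x
    unfolding A_def using that
    by (auto; metis le_less_trans real_arch_simple)
  \<comment> \<open>\<open>ergodic\<close> asks for exact invariance. By the recursion the maxima at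
    x and at T x differ by \<open>f x\<close>, up to truncation at 0, so they are unbounded
    together.\<close>
  have A_T: "T x \<in> A \<longleftrightarrow> x \<in> A" if x: "x \<in> space N" for x
  proof -
    have "(\<forall>B. \<exists>n. ?m n (T x) > B) \<longleftrightarrow> (\<forall>B. \<exists>n. ?m n x > B)"
    proof (intro iffI allI)
      fix B assume "\<forall>B. \<exists>n. ?m n (T x) > B"
      then obtain n where "?m n (T x) > B - f x" by blast
      then have "?m (Suc n) x > B" by simp
      then show "\<exists>n. ?m n x > B" ..
    next
      fix B assume "\<forall>B. \<exists>n. ?m n x > B"
      \<comment> \<open>The bound 0 rules out \<open>n = 0\<close> and makes the truncation in the
        recursion inactive.\<close>
      then obtain n where n: "?m n x > max 0 (B + f x)" by blast
      then obtain k where "n = Suc k" by (cases n) auto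
      with n have "?m k (T x) > B" by (auto simp: max_def split: if_splits)
      then show "\<exists>n. ?m n (T x) > B" ..
    qed
    with inA[OF x] inA[OF T_space[OF x]] show ?thesis by simp
  qed
  then have A_inv: "T -` A \<inter> space N = A" by (auto simp: A_def)
  let ?g = "\<lambda>n x. indicator A x * (?m (Suc n) x - ?m n (T x)) :: real"
  \<comment> \<open>The increment is \<open>f x\<close> cut off from below at a nonpositive level:
    it is dominated by |f x|, and equals \<open>f x\<close> once the maximum at T x exceeds
    \<open>- f x\<close>.\<close>
  have g_eq: "?m (Suc n) x - ?m n (T x) = max (- ?m n (T x)) (f x)" for n x by simp
  \<comment> \<open>On the invariant set A the increments g n have nonnegative integral and converge to f, so the
    integral of f over A is nonnegative; ergodicity and the negative mean of f then force A to be null.\<close>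
  have g_nonneg: "0 \<le> (LINT x|N. ?g n x)" for n
  proof -
    have int: "integrable N (\<lambda>x. indicator A x * u x)" if "integrable N u" for u :: "'b \<Rightarrow> real"
      using integrable_mult_indicator[OF A_sets that] by simp
    \<comment> \<open>Invariance of A moves the indicator to T x; then the whole product is a
      function of T x and measure preservation applies.\<close>
    have "(LINT x|N. indicator A x * ?m n (T x)) = (LINT x|N. indicator A (T x) * ?m n (T x))"
      by (intro Bochner_Integration.integral_cong) (auto simp: A_T split: split_indicator)
    also have "\<dots> = (LINT x|N. indicator A x * ?m n x)"
      by (rule integral_comp_T) measurable
    finally have "(LINT x|N. ?g n x) = (LINT x|N. indicator A x * ?m (Suc n) x) - (LINT x|N. indicator A x * ?m n x)"
      unfolding right_diff_distrib
      by (subst Bochner_Integration.integral_diff[OF int[OF m_int] int[OF integrable_comp_T[OF m_int]]]) simp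
    also have "\<dots> \<ge> 0"
      using integral_mono[OF integrable_mult_indicator[OF A_sets m_int[of n]]
          integrable_mult_indicator[OF A_sets m_int[of "Suc n"]]] birkhoff_max_mono_Suc[of f n]
      by (simp add: mult_left_mono del: birkhoff_max.simps)
    finally show ?thesis .
  qed
  have "(\<lambda>n. LINT x|N. ?g n x) \<longlonglongrightarrow> (LINT x|N. indicator A x * f x)"
  proof (rule integral_dominated_convergence[where w = "\<lambda>x. \<bar>f x\<bar>"])
    show "AE x in N. (\<lambda>n. ?g n x) \<longlonglongrightarrow> indicator A x * f x"
    proof (rule AE_I2)
      fix x assume x: "x \<in> space N"
      show "(\<lambda>n. ?g n x) \<longlonglongrightarrow> indicator A x * f x"
      proof (cases "x \<in> A")
        case True
        then have "T x \<in> A" using A_T x by simp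
        then obtain k where k: "?m k (T x) > - f x" using inA[OF T_space[OF x]] by blast
        have "eventually (\<lambda>n. ?g n x = indicator A x * f x) sequentially"
          using eventually_ge_at_top[of k]
        proof eventually_elim
          case (elim n)
          then have "?m n (T x) > - f x" using birkhoff_max_mono[OF elim, of f "T x"] k by linarith
          then show ?case unfolding g_eq by (simp add: max_def)
        qed
        then show ?thesis by (rule tendsto_eventually)
      qed simp
    qed
    show "AE x in N. norm (?g n x) \<le> \<bar>f x\<bar>" for n
    proof (rule AE_I2)
      fix x
      have "\<bar>max (- ?m n (T x)) (f x)\<bar> \<le> \<bar>f x\<bar>"
        using birkhoff_max_nonneg[of f n "T x"] by linarith
      then show "norm (?g n x) \<le> \<bar>f x\<bar>" unfolding g_eq by (simp add: indicator_def)
    qed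
  qed (use f in \<open>auto simp del: birkhoff_max.simps\<close>)
  then have nonneg: "0 \<le> (LINT x|N. indicator A x * f x)"
    using g_nonneg by (intro LIMSEQ_le_const) auto
  have "prob A \<noteq> 1"
  proof
    assume "prob A = 1"
    then have "AE x in N. x \<in> A" by (simp add: prob_eq_1)
    then have "(LINT x|N. indicator A x * f x) = (LINT x|N. f x)"
      by (intro integral_cong_AE) auto
    with nonneg neg show False by simp
  qed
  with ergodic[OF A_sets A_inv] have "prob A = 0" by auto
  then have "AE x in N. x \<notin> A" by (simp add: prob_eq_0)
  with AE_space show ?thesis
  proof eventually_elim
    case (elim x)
    with inA obtain B where "\<And>n. ?m n x \<le> B" by (metis not_less)
    then show ?case using birkhoff_sum_le_max order_trans by blast
  qed
qed

lemma birkhoff_sum_uminus: "birkhoff_sum (\<lambda>x. - f x) n x = - birkhoff_sum f n x"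
  by (simp add: birkhoff_sum_def sum_negf)

text \<open>Countably many margins suffice to bound the limsup, and they leave a single null
  set.\<close>

lemma birkhoff_upper:
  assumes f: "integrable N f"
  shows "AE x in N. \<forall>k. eventually (\<lambda>n. birkhoff_sum f n x / real n < (LINT x|N. f x) + 1 / real (Suc k)) sequentially"
  unfolding AE_all_countable
proof
  fix k
  \<comment> \<open>Half of the margin makes the mean of the shifted function negative; the other
    half absorbs \<open>B / real n\<close>.\<close>
  define e where "e = 1 / (2 * real (Suc k))"
  have e: "e > 0" by (simp add: e_def)
  have "AE x in N. \<exists>B. \<forall>n. birkhoff_sum (\<lambda>x. f x - ((LINT x|N. f x) + e)) n x \<le> B"
    using f e by (intro birkhoff_sum_bounded_above) (auto simp: prob_space)
  then show "AE x in N. eventually (\<lambda>n. birkhoff_sum f n x / real n < (LINT x|N. f x) + 1 / real (Suc k)) sequentially"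
  proof eventually_elim
    case (elim x)
    then obtain B where B: "\<And>n. birkhoff_sum f n x - real n * ((LINT x|N. f x) + e) \<le> B"
      by (auto simp: birkhoff_sum_def sum_subtractf)
    have "(\<lambda>n. B / real n) \<longlonglongrightarrow> 0" by (rule lim_const_over_n)
    from order_tendstoD(2)[OF this e] eventually_gt_at_top[of 0] show ?case
    proof eventually_elim
      case (elim n)
      have "birkhoff_sum f n x / real n \<le> (B + real n * ((LINT x|N. f x) + e)) / real n"
        using B[of n] by (intro divide_right_mono) auto
      also have "\<dots> = B / real n + (LINT x|N. f x) + e"
        using elim by (simp add: field_simps)
      also have "\<dots> < (LINT x|N. f x) + 2 * e" using elim by simp
      also have "2 * e = 1 / real (Suc k)" unfolding e_def by (simp add: divide_simps)
      finally show ?case .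
    qed
  qed
qed

theorem birkhoff:
  assumes f: "integrable N f"
  shows "AE x in N. (\<lambda>n. birkhoff_sum f n x / real n) \<longlonglongrightarrow> (LINT x|N. f x)"
  using birkhoff_upper[OF f] birkhoff_upper[OF Bochner_Integration.integrable_minus[OF f]]
proof eventually_elim
  case (elim x)
  show ?case
  proof (rule LIMSEQ_I)
    fix r :: real assume "0 < r"
    then obtain k where k: "1 / real (Suc k) < r" using nat_approx_posE by blast
    have "eventually (\<lambda>n. norm (birkhoff_sum f n x / real n - (LINT x|N. f x)) < r) sequentially"
      using elim(1)[rule_format, of k] elim(2)[rule_format, of k]
      by eventually_elim (use k in \<open>auto simp: birkhoff_sum_uminus\<close>)
    then show "\<exists>N0. \<forall>n\<ge>N0. norm (birkhoff_sum f n x / real n - (LINT x|N. f x)) < r"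
      by (simp add: eventually_sequentially)
  qed
qed

end

subsection \<open>Stationary ergodic sequences\<close>

lemma measurable_seq_shift [measurable]:
  "seq_shift \<in> measurable (PiM UNIV (\<lambda>_. borel :: real measure)) (PiM UNIV (\<lambda>_. borel))"
  unfolding seq_shift_def by (rule measurable_PiM_single') auto

locale stationary_ergodic = prob_space M for M :: "'a measure" +
  fixes X :: "nat \<Rightarrow> 'a \<Rightarrow> real"
  assumes measurable_X [measurable]: "\<And>i. X i \<in> borel_measurable M"
    and stationary: "strictly_stationary M X"
    and ergodic: "ergodic_seq M X"
begin

text \<open>The space of \<open>M\<close> need not carry a transformation that generates X; on the
  space of sequences the shift does.\<close>

definition path_law :: "(nat \<Rightarrow> real) measure" where
  "path_law = distr M (PiM UNIV (\<lambda>_. borel)) (\<lambda>\<omega> i. X i \<omega>)"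

lemma measurable_path [measurable]: "(\<lambda>\<omega> i. X i \<omega>) \<in> measurable M (PiM UNIV (\<lambda>_. borel))"
  by (rule measurable_PiM_single') auto

text \<open>Cylinders determine a finite measure on the product, and a cylinder over J involves only
  an initial segment of coordinates, where stationarity applies with lag 1.\<close>

lemma seq_shift_preserves: "distr path_law path_law seq_shift = path_law"
proof (rule measure_eqI_PiM_infinite)
  interpret P: prob_space path_law unfolding path_law_def by (rule prob_space_distr) measurable
  have m: "seq_shift \<in> measurable path_law path_law" 
    using measurable_seq_shift by (simp add: path_law_def)
  interpret Q: prob_space "distr path_law path_law seq_shift" by (rule P.prob_space_distr[OF m])
  show "finite_measure (distr path_law path_law seq_shift)" by unfold_locales
  fix A :: "nat \<Rightarrow> real set" and J :: "nat set"
  assume J: "finite J" and A: "\<And>i. i \<in> J \<Longrightarrow> A i \<in> sets borel"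
  let ?E = "prod_emb UNIV (\<lambda>_. borel) J (Pi\<^sub>E J A)"
  obtain n where n: "J \<subseteq> {..<n}" using finite_nat_iff_bounded J by blast
  let ?F = "prod_emb {..<n} (\<lambda>_. borel :: real measure) J (Pi\<^sub>E J A)"
  have [measurable]: "?F \<in> sets (PiM {..<n} (\<lambda>_. borel))"
    using J A n by (intro sets_PiM_I) auto
  have [measurable]: "?E \<in> sets (PiM UNIV (\<lambda>_. borel))"
    using J A n by (intro sets_PiM_I) auto
  have mk: "(\<lambda>\<omega>. \<lambda>i\<in>{..<n}. X (i + k) \<omega>) \<in> measurable M (PiM {..<n} (\<lambda>_. borel))" for k
    by (rule measurable_restrict) auto
  \<comment> \<open>The lag is left general: \<open>k = 1\<close> describes the shifted path and
    \<open>k = 0\<close> the original one.\<close>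
  have F: "emeasure (distr M (PiM {..<n} (\<lambda>_. borel)) (\<lambda>\<omega>. \<lambda>i\<in>{..<n}. X (i + k) \<omega>)) ?F
      = emeasure M {\<omega> \<in> space M. \<forall>i\<in>J. X (i + k) \<omega> \<in> A i}" for k
  proof -
    have "?F = {y \<in> space (PiM {..<n} (\<lambda>_. borel)). \<forall>i\<in>J. y i \<in> A i}"
      using n by (auto simp: prod_emb_def space_PiM PiE_iff extensional_def)
    then have "(\<lambda>\<omega>. \<lambda>i\<in>{..<n}. X (i + k) \<omega>) -` ?F \<inter> space M = {\<omega> \<in> space M. \<forall>i\<in>J. X (i + k) \<omega> \<in> A i}"
      using n by (auto simp: space_PiM PiE_iff subset_iff)
    with emeasure_distr[OF mk, of ?F] show ?thesis by simp
  qed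
  have E: "?E = {y. \<forall>i\<in>J. y i \<in> A i}"
    by (auto simp: prod_emb_def PiE_iff)
  have shift: "(\<lambda>\<omega>. seq_shift (\<lambda>i. X i \<omega>)) \<in> measurable M (PiM UNIV (\<lambda>_. borel))"
    by (rule measurable_compose[OF measurable_path measurable_seq_shift])
  have "distr path_law path_law seq_shift = distr M (PiM UNIV (\<lambda>_. borel)) (\<lambda>\<omega>. seq_shift (\<lambda>i. X i \<omega>))"
    unfolding path_law_def
    by (subst distr_distr) (use m in \<open>auto simp: path_law_def comp_def cong: distr_cong\<close>)
  then have "emeasure (distr path_law path_law seq_shift) ?E = emeasure M {\<omega> \<in> space M. \<forall>i\<in>J. X (i + 1) \<omega> \<in> A i}"
    using \<open>?E \<in> _\<close> unfolding E
    by (simp add: emeasure_distr[OF shift]) (simp add: seq_shift_def Int_def conj_commute)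
  also have "\<dots> = emeasure M {\<omega> \<in> space M. \<forall>i\<in>J. X (i + 0) \<omega> \<in> A i}"
    unfolding F[symmetric] using stationary[unfolded strictly_stationary_def, rule_format, of n 1]
    by (simp only: add_0_right)
  also have "\<dots> = emeasure path_law ?E"
    using \<open>?E \<in> _\<close> unfolding E path_law_def
    by (simp add: emeasure_distr[OF measurable_path] Int_def conj_commute)
  finally show "emeasure (distr path_law path_law seq_shift) ?E = emeasure path_law ?E" .
qed (auto simp: path_law_def)

sublocale path: ergodic_map path_law seq_shift
proof -
  interpret P: prob_space path_law unfolding path_law_def by (rule prob_space_distr) measurable
  show "ergodic_map path_law seq_shift"
  proof
    show "seq_shift \<in> path_law \<rightarrow>\<^sub>M path_law" using measurable_seq_shift by (simp add: path_law_def)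
    fix A assume A: "A \<in> P.events" and inv: "seq_shift -` A \<inter> space path_law = A"
    then have "P.prob A = measure M {\<omega> \<in> space M. (\<lambda>i. X i \<omega>) \<in> A}"
      unfolding path_law_def by (subst measure_distr) (auto intro!: arg_cong2[where f=measure])
    with ergodic A inv show "P.prob A \<in> {0, 1}"
      by (auto simp: ergodic_seq_def path_law_def)
  qed (rule seq_shift_preserves)
qed

lemma seq_shift_funpow: "(seq_shift ^^ i) y j = y (i + j)"
  by (induction i arbitrary: j) (simp_all add: seq_shift_def)

text \<open>For a function of coordinate 0 the Birkhoff sums along the shift are the sums along the
  sequence; the null set is then pulled back from \<open>path_law\<close> to
  \<open>M\<close>.\<close>

theorem slln:
  fixes g :: "real \<Rightarrow> real"
  assumes [measurable]: "g \<in> borel_measurable borel" and g: "integrable M (\<lambda>\<omega>. g (X 0 \<omega>))"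
  shows "AE \<omega> in M. (\<lambda>n. (\<Sum>i<n. g (X i \<omega>)) / real n) \<longlonglongrightarrow> (LINT \<omega>|M. g (X 0 \<omega>))"
proof -
  have "integrable path_law (\<lambda>y. g (y 0))"
    unfolding path_law_def using g by (subst integrable_distr_eq) auto
  from path.birkhoff[OF this] 
  have "AE y in path_law. (\<lambda>n. (\<Sum>i<n. g (y i)) / real n) \<longlonglongrightarrow> (LINT y|path_law. g (y 0))"
    by (simp add: path.birkhoff_sum_def seq_shift_funpow)
  moreover have "(LINT y|path_law. g (y 0)) = (LINT \<omega>|M. g (X 0 \<omega>))"
    unfolding path_law_def by (subst integral_distr) auto
  ultimately show ?thesis
    unfolding path_law_def by (auto dest!: AE_distrD[OF measurable_path])
qed

end

subsection \<open>Order statistics and quantile functions\<close>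

text \<open>In a sorted list the entries at most a occupy an initial segment of positions, so its
  length decides whether position k belongs to it.\<close>

lemma sorted_nth_le_iff:
  fixes xs :: "'a::linorder list"
  assumes "sorted xs" "k < length xs"
  shows "xs ! k \<le> a \<longleftrightarrow> k < card {i. i < length xs \<and> xs ! i \<le> a}"
proof
  assume "xs ! k \<le> a"
  then have "{..k} \<subseteq> {i. i < length xs \<and> xs ! i \<le> a}"
    using assms by (auto intro: order_trans[OF sorted_nth_mono])
  from card_mono[OF _ this] show "k < card {i. i < length xs \<and> xs ! i \<le> a}" by simp
next
  assume *: "k < card {i. i < length xs \<and> xs ! i \<le> a}"
  show "xs ! k \<le> a"
  proof (rule ccontr)
    assume "\<not> xs ! k \<le> a"
    then have "{i. i < length xs \<and> xs ! i \<le> a} \<subseteq> {..<k}"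
      using sorted_nth_mono[OF assms(1)] by (auto simp: not_le) (meson leD le_less_trans not_le)
    from card_mono[OF _ this] * show False by simp
  qed
qed

definition empirical_cdf :: "(nat \<Rightarrow> 'a \<Rightarrow> real) \<Rightarrow> nat \<Rightarrow> 'a \<Rightarrow> real \<Rightarrow> real" where
  "empirical_cdf X n \<omega> a = real (card {j. j < n \<and> X j \<omega> \<le> a}) / real n"

text \<open>Sorting does not change the number of entries at most a. Order statistics are indexed
  from 1 and list positions from 0, hence a weak inequality here against the strict one for
  lists.\<close>

lemma order_stat_le_iff:
  assumes "1 \<le> i" "i \<le> n"
  shows "order_stat X n i \<omega> \<le> a \<longleftrightarrow> i \<le> card {j. j < n \<and> X j \<omega> \<le> a}"
proof -
  let ?xs = "map (\<lambda>j. X j \<omega>) [0..<n]"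
  have "card {j. j < n \<and> X j \<omega> \<le> a} = length (filter (\<lambda>x. x \<le> a) ?xs)"
    by (simp add: length_filter_conv_card cong: conj_cong)
  also have "\<dots> = length (filter (\<lambda>x. x \<le> a) (sort ?xs))"
    by (metis mset_filter mset_sort size_mset)
  also have "\<dots> = card {k. k < length (sort ?xs) \<and> sort ?xs ! k \<le> a}"
    by (rule length_filter_conv_card)
  finally show ?thesis
    using sorted_nth_le_iff[OF sorted_sort[of ?xs], of "i - 1" a] assms
    by (auto simp: order_stat_def)
qed

text \<open>Turns an average over the order statistics into an ergodic average, to which
  \<open>slln\<close> applies.\<close>

lemma sum_order_stat:
  fixes f :: "real \<Rightarrow> 'b::comm_monoid_add"
  shows "(\<Sum>i=1..n. f (order_stat X n i \<omega>)) = (\<Sum>j<n. f (X j \<omega>))"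
proof -
  let ?xs = "map (\<lambda>j. X j \<omega>) [0..<n]"
  have "(\<Sum>i=1..n. f (order_stat X n i \<omega>)) = (\<Sum>i<n. f (sort ?xs ! i))"
    unfolding order_stat_def by (rule sum.reindex_bij_witness[of _ Suc "\<lambda>i. i - 1"]) auto
  also have "\<dots> = sum_list (map f (sort ?xs))"
    by (simp add: sum_list_sum_nth atLeast0LessThan)
  also have "\<dots> = sum_list (map f ?xs)"
    by (metis mset_map mset_sort sum_mset_sum_list)
  also have "\<dots> = (\<Sum>j<n. f (X j \<omega>))"
    by (simp add: sum_list_sum_nth atLeast0LessThan)
  finally show ?thesis .
qed

section \<open>Step functions on the unit interval\<close>

abbreviation unif :: "real measure" where
  "unif \<equiv> restrict_space lborel {0<..<1}"

interpretation unif: prob_space unif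
  by (auto simp: emeasure_restrict_space space_restrict_space intro!: prob_spaceI)

text \<open>For t in (0,1) and n > 0 this is the index i with t in ((i-1)/n, i/n].\<close>

definition cell :: "nat \<Rightarrow> real \<Rightarrow> nat" where
  "cell n t = nat \<lceil>real n * t\<rceil>"

lemma measurable_cell [measurable]: "cell n \<in> measurable unif (count_space UNIV)"
proof -
  have "(\<lambda>t. t) \<in> borel_measurable unif" by (intro measurable_restrict_space1) simp
  moreover have "(\<lambda>t::real. nat \<lceil>real n * t\<rceil>) \<in> measurable borel (count_space UNIV)"
    by measurable
  ultimately show ?thesis
    unfolding cell_def by (rule measurable_compose)
qed

lemma sets_cell: "{t \<in> space unif. cell n t = i} \<in> sets unif"
  by measurable

lemma cell_range:
  assumes "0 < n" "t \<in> {0<..<1}"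
  shows "cell n t \<in> {1..n}"
proof -
  have "0 < real n * t" "real n * t \<le> real n" using assms by auto
  then show ?thesis unfolding cell_def by (auto simp: nat_le_iff ceiling_le_iff le_nat_iff one_le_ceiling)
qed

lemma cell_le_iff:
  assumes "0 < n"
  shows "cell n t \<le> k \<longleftrightarrow> t \<le> real k / real n"
  using assms by (simp add: cell_def nat_le_iff ceiling_le_iff field_simps)

lemma emeasure_cell:
  assumes n: "0 < n" and i: "i \<in> {1..n}"
  shows "emeasure unif {t \<in> space unif. cell n t = i} = ennreal (1 / real n)"
proof -
  have eq: "{t \<in> space unif. cell n t = i} = {real (i - 1) / real n <.. real i / real n} \<inter> {0<..<1}"
  proof -
    have "cell n t = i \<longleftrightarrow> cell n t \<le> i \<and> \<not> cell n t \<le> i - 1" for t using i by auto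
    moreover have "{t \<in> space unif. t \<le> b \<and> \<not> t \<le> a} = {a<..b} \<inter> {0<..<1}" for a b
      by (auto simp: space_restrict_space)
    ultimately show ?thesis unfolding cell_le_iff[OF n] by simp
  qed
  have i': "real i / real n \<le> 1" "0 \<le> real (i - 1) / real n" and len: "real i / real n - real (i - 1) / real n = 1 / real n"
    using n i by (auto simp: field_simps of_nat_diff)
  have "emeasure unif {t \<in> space unif. cell n t = i}
      = emeasure lborel ({real (i - 1) / real n <.. real i / real n} \<inter> {0<..<1})"
    unfolding eq by (rule emeasure_restrict_space) auto
  also have "\<dots> = ennreal (1 / real n)"
  \<comment> \<open>Intersecting with the open unit interval can only remove the point 1, when
    \<open>i = n\<close>; the cell is squeezed between an open and a half-open interval of length
    1/n.\<close>
  proof (rule antisym)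
    have "emeasure lborel ({real (i - 1) / real n <.. real i / real n} \<inter> {0<..<1})
        \<le> emeasure lborel {real (i - 1) / real n <.. real i / real n}"
      by (rule emeasure_mono) auto
    then show "emeasure lborel ({real (i - 1) / real n <.. real i / real n} \<inter> {0<..<1}) \<le> ennreal (1 / real n)"
      using n len by (subst (asm) emeasure_lborel_Ioc) (auto intro: divide_right_mono)
    have "emeasure lborel {real (i - 1) / real n <..< real i / real n}
        \<le> emeasure lborel ({real (i - 1) / real n <.. real i / real n} \<inter> {0<..<1})"
    proof (intro emeasure_mono subsetI)
      fix x assume "x \<in> {real (i - 1) / real n <..< real i / real n}"
      with i' show "x \<in> {real (i - 1) / real n <.. real i / real n} \<inter> {0<..<1}"
        unfolding greaterThanLessThan_iff greaterThanAtMost_iff Int_iff by linarith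
    qed simp
    then show "ennreal (1 / real n) \<le> emeasure lborel ({real (i - 1) / real n <.. real i / real n} \<inter> {0<..<1})"
      using n len by (subst (asm) emeasure_lborel_Ioo) (auto intro: divide_right_mono)
  qed
  finally show ?thesis .
qed

lemma nn_integral_cell:
  assumes n: "0 < n"
  shows "(\<integral>\<^sup>+t. f (cell n t) \<partial>unif) = (\<Sum>i=1..n. f i) * ennreal (1 / real n)"
proof -
  have "(\<integral>\<^sup>+t. f (cell n t) \<partial>unif) = (\<integral>\<^sup>+t. (\<Sum>i=1..n. f i * indicator {t \<in> space unif. cell n t = i} t) \<partial>unif)"
  proof (rule nn_integral_cong)
    fix t assume t: "t \<in> space unif"
    then have "cell n t \<in> {1..n}" using cell_range[OF n] by (simp add: space_restrict_space)
    then show "f (cell n t) = (\<Sum>i=1..n. f i * indicator {t \<in> space unif. cell n t = i} t)"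
      using t by (simp add: indicator_def if_distrib[of "\<lambda>x. _ * x"] cong: if_cong)
  qed
  also have "\<dots> = (\<Sum>i=1..n. f i * emeasure unif {t \<in> space unif. cell n t = i})"
    using sets_cell by (subst nn_integral_sum) (measurable, intro sum.cong refl nn_integral_cmult_indicator)
  also have "\<dots> = (\<Sum>i=1..n. f i) * ennreal (1 / real n)"
    using emeasure_cell[OF n] by (simp add: sum_distrib_right)
  finally show ?thesis .
qed

lemma integrable_cell:
  fixes f :: "nat \<Rightarrow> real"
  assumes n: "0 < n"
  shows "integrable unif (\<lambda>t. f (cell n t))"
proof (rule unif.integrable_const_bound)
  show "AE t in unif. norm (f (cell n t)) \<le> Max ((\<lambda>i. \<bar>f i\<bar>) ` {1..n})"
    using cell_range[OF n] by (intro AE_I2) (auto simp: space_restrict_space intro!: Max_ge)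
qed measurable

lemma integral_cell:
  fixes f :: "nat \<Rightarrow> real"
  assumes n: "0 < n"
  shows "(LINT t|unif. f (cell n t)) = (\<Sum>i=1..n. f i) / real n"
proof -
  have "(LINT t|unif. f (cell n t)) = (LINT t|unif. (\<Sum>i=1..n. f i * indicator {t \<in> space unif. cell n t = i} t))"
  proof (rule Bochner_Integration.integral_cong[OF refl])
    fix t assume t: "t \<in> space unif"
    then have "cell n t \<in> {1..n}" using cell_range[OF n] by (simp add: space_restrict_space)
    then show "f (cell n t) = (\<Sum>i=1..n. f i * indicator {t \<in> space unif. cell n t = i} t)"
      using t by (simp add: indicator_def if_distrib[of "\<lambda>x. _ * x"] cong: if_cong)
  qed
  also have "\<dots> = (\<Sum>i=1..n. f i * measure unif {t \<in> space unif. cell n t = i})"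
    using sets_cell
    by (subst Bochner_Integration.integral_sum)
      (auto intro!: sum.cong integrable_mult_right integrable_real_indicator
        simp: unif.emeasure_eq_measure Int_absorb2 sets.sets_into_space simp del: space_restrict_space space_restrict_space2)
  also have "\<dots> = (\<Sum>i=1..n. f i) / real n"
    using emeasure_cell[OF n] by (simp add: measure_def sum_divide_distrib)
  finally show ?thesis .
qed

lemma tendsto_0_le_ennreal:
  fixes f g :: "'a \<Rightarrow> ennreal"
  assumes "eventually (\<lambda>x. f x \<le> g x) L" "(g \<longlongrightarrow> 0) L"
  shows "(f \<longlongrightarrow> 0) L"
  by (rule tendsto_sandwich[of "\<lambda>_. 0" f L g]) (use assms in auto)

text \<open>The sum is at most three times its largest term. This works for every positive p and
  takes the place of the triangle inequality in Lp.\<close>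

lemma powr_sum3_le:
  fixes a b c p :: real
  assumes "0 < p"
  shows "\<bar>a + b + c\<bar> powr p \<le> 3 powr p * (\<bar>a\<bar> powr p + \<bar>b\<bar> powr p + \<bar>c\<bar> powr p)"
proof -
  define m where "m = max \<bar>a\<bar> (max \<bar>b\<bar> \<bar>c\<bar>)"
  have "\<bar>a + b + c\<bar> powr p \<le> (3 * m) powr p"
    using assms by (intro powr_mono2) (auto simp: m_def)
  also have "\<dots> = 3 powr p * m powr p" by (simp add: m_def powr_mult)
  also have "m powr p \<le> \<bar>a\<bar> powr p + \<bar>b\<bar> powr p + \<bar>c\<bar> powr p"
    unfolding m_def by (simp add: max_def)
  finally show ?thesis by simp
qed

section \<open>Quantile functions of the law and of the sample\<close>

context stationary_ergodic
begin

abbreviation F :: "real \<Rightarrow> real" where "F \<equiv> distr_fun M (X 0)"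
abbreviation qf :: "real \<Rightarrow> real" where "qf \<equiv> quantile F"
abbreviation law :: "real measure" where "law \<equiv> distr M borel (X 0)"
abbreviation emp_qf :: "nat \<Rightarrow> 'a \<Rightarrow> real \<Rightarrow> real" where
  "emp_qf n \<omega> t \<equiv> order_stat X n (cell n t) \<omega>"

lemma F_cdf: "F = cdf law"
  by (rule ext) (simp add: distr_fun_def cdf_def measure_distr vimage_def Int_def conj_commute)

sublocale law: cdf_distribution law
  unfolding cdf_distribution_def by (rule real_distribution_distr) simp

lemma qf_le_iff: "t \<in> {0<..<1} \<Longrightarrow> qf t \<le> a \<longleftrightarrow> t \<le> F a"
  using law.pseudoinverse[of t a] by (simp add: quantile_def F_cdf)

lemma qf_eq: "qf = law.I"
  by (rule ext) (simp add: quantile_def F_cdf)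

lemma measurable_qf [measurable]: "qf \<in> borel_measurable unif"
  using law.measurable_CI unfolding qf_eq by (simp add: measurable_def sets_restrict_space space_restrict_space)

lemma distr_qf: "distr unif borel qf = law"
  unfolding qf_eq by (rule law.distr_I_eq_M)

text \<open>Identifies \<open>emp_qf\<close> as the pseudoinverse of the empirical distribution
  function, in the same form as \<open>qf_le_iff\<close>: comparing either quantile with a amounts
  to comparing t with a number.\<close>

lemma emp_qf_le_iff:
  assumes "0 < n" "t \<in> {0<..<1}"
  shows "emp_qf n \<omega> t \<le> a \<longleftrightarrow> t \<le> empirical_cdf X n \<omega> a"
  using cell_range[OF assms] assms(1)
  by (simp add: order_stat_le_iff cell_le_iff empirical_cdf_def)

lemma slln_sets:
  assumes [measurable]: "B \<in> sets borel"
  shows "AE \<omega> in M. (\<lambda>n. real (card {j. j < n \<and> X j \<omega> \<in> B}) / real n) \<longlonglongrightarrow> measure law B"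
proof -
  have "integrable M (\<lambda>\<omega>. indicator B (X 0 \<omega>) :: real)"
    by (rule integrable_const_bound[where B = 1]) auto
  from slln[OF _ this] have "AE \<omega> in M. (\<lambda>n. (\<Sum>i<n. indicator B (X i \<omega>)) / real n) \<longlonglongrightarrow> (LINT \<omega>|M. indicator B (X 0 \<omega>) :: real)"
    by simp
  moreover have "(LINT \<omega>|M. indicator B (X 0 \<omega>) :: real) = (LINT x|law. indicator B x)"
    by (rule integral_distr[symmetric]) auto
  moreover have "(\<Sum>i<n. indicator B (X i \<omega>)) = real (card {j. j < n \<and> X j \<omega> \<in> B})" for n \<omega>
    by (simp add: indicator_def sum.If_cases Int_def)
  ultimately show ?thesis by simp
qed

lemma empirical_cdf_tendsto: "AE \<omega> in M. (\<lambda>n. empirical_cdf X n \<omega> a) \<longlonglongrightarrow> F a"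
  using slln_sets[of "{..a}"] by (simp add: empirical_cdf_def F_cdf cdf_def)

section \<open>Lp convergence along the empirical quantile function\<close>

definition qdist :: "real \<Rightarrow> (real \<Rightarrow> real) \<Rightarrow> nat \<Rightarrow> 'a \<Rightarrow> ennreal" where
  "qdist p g n \<omega> = (\<integral>\<^sup>+t. ennreal (\<bar>g (emp_qf n \<omega> t) - g (qf t)\<bar> powr p) \<partial>unif)"

text \<open>\<open>qdist\<close> is the p-th power of an Lp distance, valued in
  \<open>ennreal\<close> so that it makes sense before any integrability is known. The null set may
  depend on g.\<close>

definition qconv :: "real \<Rightarrow> (real \<Rightarrow> real) \<Rightarrow> bool" where
  "qconv p g \<longleftrightarrow> (AE \<omega> in M. (\<lambda>n. qdist p g n \<omega>) \<longlonglongrightarrow> 0)"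

lemma measurable_emp_qf [measurable]: "emp_qf n \<omega> \<in> borel_measurable unif"
  by (rule measurable_compose[OF measurable_cell]) simp

text \<open>The three pieces will be the approximation error at the sample, the approximant between
  the two quantiles, and the approximation error at the law. Sums of two functions use it with
  \<open>c\<close> zero.\<close>

lemma qdist_sum3:
  assumes p: "0 < p" and [measurable]: "a \<in> borel_measurable unif" "b \<in> borel_measurable unif" "c \<in> borel_measurable unif"
    and le: "\<And>t. \<bar>g (emp_qf n \<omega> t) - g (qf t)\<bar> \<le> \<bar>a t + b t + c t\<bar>"
  shows "qdist p g n \<omega> \<le> ennreal (3 powr p) * ((\<integral>\<^sup>+t. ennreal (\<bar>a t\<bar> powr p) \<partial>unif)
      + (\<integral>\<^sup>+t. ennreal (\<bar>b t\<bar> powr p) \<partial>unif) + (\<integral>\<^sup>+t. ennreal (\<bar>c t\<bar> powr p) \<partial>unif))"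
proof -
  have "qdist p g n \<omega> \<le> (\<integral>\<^sup>+t. ennreal (3 powr p) * (ennreal (\<bar>a t\<bar> powr p) + ennreal (\<bar>b t\<bar> powr p) + ennreal (\<bar>c t\<bar> powr p)) \<partial>unif)"
    unfolding qdist_def
  proof (rule nn_integral_mono)
    fix t
    have "\<bar>g (emp_qf n \<omega> t) - g (qf t)\<bar> powr p \<le> \<bar>a t + b t + c t\<bar> powr p"
      using p le by (intro powr_mono2) auto
    also note powr_sum3_le[OF p]
    finally show "ennreal (\<bar>g (emp_qf n \<omega> t) - g (qf t)\<bar> powr p)
        \<le> ennreal (3 powr p) * (ennreal (\<bar>a t\<bar> powr p) + ennreal (\<bar>b t\<bar> powr p) + ennreal (\<bar>c t\<bar> powr p))"
      by (simp add: ennreal_plus[symmetric] ennreal_mult[symmetric] ennreal_leI del: ennreal_plus)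
  qed
  also have "\<dots> = ennreal (3 powr p) * ((\<integral>\<^sup>+t. ennreal (\<bar>a t\<bar> powr p) \<partial>unif)
      + (\<integral>\<^sup>+t. ennreal (\<bar>b t\<bar> powr p) \<partial>unif) + (\<integral>\<^sup>+t. ennreal (\<bar>c t\<bar> powr p) \<partial>unif))"
    by (subst nn_integral_cmult, measurable) (simp add: nn_integral_add)
  finally show ?thesis .
qed

lemma qconv_add:
  assumes p: "0 < p" and [measurable]: "u \<in> borel_measurable borel" "v \<in> borel_measurable borel"
    and u: "qconv p u" and v: "qconv p v"
  shows "qconv p (\<lambda>x. u x + v x)"
  using u v unfolding qconv_def
proof eventually_elim
  case (elim \<omega>)
  have "(\<lambda>n. ennreal (3 powr p) * (qdist p u n \<omega> + qdist p v n \<omega> + 0)) \<longlonglongrightarrow> ennreal (3 powr p) * (0 + 0 + 0)"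
    using elim by (intro ennreal_tendsto_cmult tendsto_add tendsto_const) auto
  then have lim: "(\<lambda>n. ennreal (3 powr p) * (qdist p u n \<omega> + qdist p v n \<omega> + 0)) \<longlonglongrightarrow> 0" by simp
  have "qdist p (\<lambda>x. u x + v x) n \<omega> \<le> ennreal (3 powr p) * (qdist p u n \<omega> + qdist p v n \<omega> + 0)" for n
    using qdist_sum3[OF p, where a = "\<lambda>t. u (emp_qf n \<omega> t) - u (qf t)" 
      and b = "\<lambda>t. v (emp_qf n \<omega> t) - v (qf t)" and c = "\<lambda>t. 0" and g = "\<lambda>x. u x + v x" and n = n and \<omega> = \<omega>]
    by (simp add: qdist_def)
  then show ?case
    by (intro tendsto_0_le_ennreal[OF always_eventually lim]) simp
qed

lemma qconv_cmult:
  assumes [measurable]: "u \<in> borel_measurable borel" and u: "qconv p u"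
  shows "qconv p (\<lambda>x. c * u x)"
  using u unfolding qconv_def
proof eventually_elim
  case (elim \<omega>)
  have "qdist p (\<lambda>x. c * u x) n \<omega> = ennreal (\<bar>c\<bar> powr p) * qdist p u n \<omega>" for n
    unfolding qdist_def
    by (subst nn_integral_cmult[symmetric])
      (auto intro!: nn_integral_cong simp: right_diff_distrib[symmetric] abs_mult powr_mult ennreal_mult')
  with ennreal_tendsto_cmult[OF _ elim, of "ennreal (\<bar>c\<bar> powr p)"] show ?case by simp
qed

lemma qconv_const: "qconv p (\<lambda>x. c)"
  by (simp add: qconv_def qdist_def)

lemma qconv_sum:
  assumes p: "0 < p" and "\<And>i. i \<in> I \<Longrightarrow> u i \<in> borel_measurable borel" "\<And>i. i \<in> I \<Longrightarrow> qconv p (u i)"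
  shows "qconv p (\<lambda>x. \<Sum>i\<in>I. u i x)"
  using assms(2,3)
proof (induction I rule: infinite_finite_induct)
  case (insert i I)
  then show ?case by (auto intro!: qconv_add[OF p])
qed (auto simp: qconv_const)

text \<open>The two indicators differ exactly for t between the empirical and the true distribution
  function at a.\<close>

lemma qconv_atMost:
  assumes p: "0 < p"
  shows "qconv p (indicator {..a})"
  using empirical_cdf_tendsto[of a] unfolding qconv_def
proof eventually_elim
  case (elim \<omega>)
  let ?e = "\<lambda>n. empirical_cdf X n \<omega> a"
  have "eventually (\<lambda>n. qdist p (indicator {..a}) n \<omega> \<le> ennreal \<bar>?e n - F a\<bar>) sequentially"
    using eventually_gt_at_top[of 0]
  proof eventually_elim
    case (elim n)
    have "qdist p (indicator {..a}) n \<omega> \<le> (\<integral>\<^sup>+t. indicator ({min (?e n) (F a)<..max (?e n) (F a)} \<inter> space unif) t \<partial>unif)"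
      unfolding qdist_def
      by (rule nn_integral_mono)
        (use elim p in \<open>auto simp: indicator_def emp_qf_le_iff qf_le_iff space_restrict_space min_def max_def\<close>)
    also have "\<dots> = emeasure unif ({min (?e n) (F a)<..max (?e n) (F a)} \<inter> space unif)"
      by (rule nn_integral_indicator) (simp add: sets_restrict_space_iff space_restrict_space)
    also have "\<dots> \<le> emeasure lborel {min (?e n) (F a)<..max (?e n) (F a)}"
      by (subst emeasure_restrict_space) (simp, simp, rule emeasure_mono, auto)
    also have "\<dots> = ennreal \<bar>?e n - F a\<bar>"
    proof -
      have "max x y - min x y = \<bar>x - y\<bar>" "min x y \<le> max x y" for x y :: real by (auto simp: max_def min_def)
      then show ?thesis by (simp only: emeasure_lborel_Ioc)
    qed
    finally show ?case .
  qed
  moreover have "(\<lambda>n. ennreal \<bar>?e n - F a\<bar>) \<longlonglongrightarrow> 0"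
    using tendsto_ennrealI[OF tendsto_rabs[OF LIM_zero[OF elim]]] by simp
  ultimately show ?case by (rule tendsto_0_le_ennreal)
qed

text \<open>Both g - u k at the sample and at the quantile function cost the same amount in the limit,
  the former by the strong law, so an approximation in Lp of the law suffices.\<close>

lemma qconv_dominated_limit:
  assumes p: "0 < p" and [measurable]: "g \<in> borel_measurable borel" "\<And>k. u k \<in> borel_measurable borel"
    and u: "\<And>k. qconv p (u k)"
    and lim: "\<And>x. (\<lambda>k. u k x) \<longlonglongrightarrow> g x"
    and bound: "\<And>k x. \<bar>u k x\<bar> \<le> 2 * \<bar>g x\<bar>"
    and int: "integrable M (\<lambda>\<omega>. \<bar>g (X 0 \<omega>)\<bar> powr p)"
  shows "qconv p g"
proof -
  define d where "d k x = \<bar>g x - u k x\<bar> powr p" for k x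
  have [measurable]: "d k \<in> borel_measurable borel" for k unfolding d_def by measurable
  have d_nonneg: "0 \<le> d k x" for k x by (simp add: d_def)
  define e where "e k = (LINT \<omega>|M. d k (X 0 \<omega>))" for k
  \<comment> \<open>The factor 3 is 1 + 2, with the 2 from \<open>bound\<close>.\<close>
  have d_le: "d k x \<le> 3 powr p * \<bar>g x\<bar> powr p" for k x
  proof -
    have "d k x \<le> (3 * \<bar>g x\<bar>) powr p"
      unfolding d_def using bound[of k x] p by (intro powr_mono2) auto
    then show ?thesis by (simp add: powr_mult)
  qed
  have d_int: "integrable M (\<lambda>\<omega>. d k (X 0 \<omega>))" for k
    by (rule Bochner_Integration.integrable_bound[OF integrable_mult_right[OF int, of "3 powr p"]])
      (use d_le d_nonneg in auto)
  have "e \<longlonglongrightarrow> (LINT \<omega>|M. (0::real))"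
    unfolding e_def
  proof (rule integral_dominated_convergence[where w = "\<lambda>\<omega>. 3 powr p * \<bar>g (X 0 \<omega>)\<bar> powr p"])
    show "AE \<omega> in M. (\<lambda>k. d k (X 0 \<omega>)) \<longlonglongrightarrow> 0"
    proof (rule AE_I2)
      fix \<omega>
      have "(\<lambda>k. \<bar>g (X 0 \<omega>) - u k (X 0 \<omega>)\<bar> powr p) \<longlonglongrightarrow> \<bar>g (X 0 \<omega>) - g (X 0 \<omega>)\<bar> powr p"
        using p by (intro tendsto_powr2 tendsto_rabs tendsto_diff tendsto_const lim) auto
      then show "(\<lambda>k. d k (X 0 \<omega>)) \<longlonglongrightarrow> 0" by (simp add: d_def)
    qed
  qed (use int d_le d_nonneg in auto)
  then have e0: "e \<longlonglongrightarrow> 0" by simp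
  have "AE \<omega> in M. \<forall>k. (\<lambda>n. (\<Sum>i<n. d k (X i \<omega>)) / real n) \<longlonglongrightarrow> e k"
    unfolding AE_all_countable e_def using slln[OF _ d_int] by simp
  moreover have "AE \<omega> in M. \<forall>k. (\<lambda>n. qdist p (u k) n \<omega>) \<longlonglongrightarrow> 0"
    unfolding AE_all_countable using u by (simp add: qconv_def)
  ultimately show ?thesis
    unfolding qconv_def
  proof eventually_elim
    case (elim \<omega>)
    let ?C = "ennreal (3 powr p)"
    have le: "qdist p g n \<omega> \<le> ?C * (ennreal ((\<Sum>i<n. d k (X i \<omega>)) / real n) + qdist p (u k) n \<omega> + ennreal (e k))"
      if n: "0 < n" for n k
    proof -
      have "qdist p g n \<omega> \<le> ?C * ((\<integral>\<^sup>+t. ennreal (d k (emp_qf n \<omega> t)) \<partial>unif) + qdist p (u k) n \<omega>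
          + (\<integral>\<^sup>+t. ennreal (d k (qf t)) \<partial>unif))"
        using qdist_sum3[OF p, where a = "\<lambda>t. g (emp_qf n \<omega> t) - u k (emp_qf n \<omega> t)" 
          and b = "\<lambda>t. u k (emp_qf n \<omega> t) - u k (qf t)" and c = "\<lambda>t. u k (qf t) - g (qf t)"
          and g = g and n = n and \<omega> = \<omega>]
        by (simp add: qdist_def d_def abs_minus_commute)
      also have "(\<integral>\<^sup>+t. ennreal (d k (emp_qf n \<omega> t)) \<partial>unif) = ennreal ((\<Sum>i<n. d k (X i \<omega>)) / real n)"
      proof -
        have "(\<integral>\<^sup>+t. ennreal (d k (emp_qf n \<omega> t)) \<partial>unif)
            = (\<Sum>i=1..n. ennreal (d k (order_stat X n i \<omega>))) * ennreal (1 / real n)"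
          by (rule nn_integral_cell[OF n])
        also have "\<dots> = ennreal ((\<Sum>i=1..n. d k (order_stat X n i \<omega>)) * (1 / real n))"
          by (subst sum_ennreal) (simp_all add: d_nonneg ennreal_mult' sum_nonneg del: times_divide_eq_right)
        finally show ?thesis unfolding sum_order_stat by simp
      qed
      also have "(\<integral>\<^sup>+t. ennreal (d k (qf t)) \<partial>unif) = (\<integral>\<^sup>+x. ennreal (d k x) \<partial>law)"
        unfolding distr_qf[symmetric] by (rule nn_integral_distr[symmetric]) measurable
      also have "\<dots> = (\<integral>\<^sup>+\<omega>. ennreal (d k (X 0 \<omega>)) \<partial>M)"
        by (rule nn_integral_distr) measurable
      also have "\<dots> = ennreal (e k)"
        unfolding e_def using d_nonneg by (intro nn_integral_eq_integral d_int) auto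
      finally show ?thesis .
    qed
    have "(\<lambda>n. ?C * (ennreal ((\<Sum>i<n. d k (X i \<omega>)) / real n) + qdist p (u k) n \<omega> + ennreal (e k)))
        \<longlonglongrightarrow> ?C * (ennreal (e k) + 0 + ennreal (e k))" for k
      using elim by (intro ennreal_tendsto_cmult tendsto_add tendsto_ennrealI tendsto_const) auto
    note lim_n = this
    have "(\<lambda>k. ?C * (ennreal (e k) + 0 + ennreal (e k))) \<longlonglongrightarrow> ?C * (ennreal 0 + 0 + ennreal 0)"
      by (intro ennreal_tendsto_cmult tendsto_add tendsto_ennrealI tendsto_const e0) auto
    then have lim_k: "(\<lambda>k. ?C * (ennreal (e k) + 0 + ennreal (e k))) \<longlonglongrightarrow> 0" by simp
    show ?case
    proof (rule order_tendstoI)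
      fix r :: ennreal assume "0 < r"
      \<comment> \<open>First k is fixed so that the limit in n of the bound is already below r;
        only then does n grow.\<close>
      from eventually_happens'[OF sequentially_bot order_tendstoD(2)[OF lim_k this]]
      obtain k where "?C * (ennreal (e k) + 0 + ennreal (e k)) < r" by blast
      from order_tendstoD(2)[OF lim_n this] eventually_gt_at_top[of 0]
      show "eventually (\<lambda>n. qdist p g n \<omega> < r) sequentially"
        by eventually_elim (use le in \<open>blast intro: le_less_trans\<close>)
    qed simp
  qed
qed

lemma qconv_indicator:
  assumes p: "0 < p" and B: "B \<in> sets borel"
  shows "qconv p (indicator B)"
proof -
  have int: "integrable M (\<lambda>\<omega>. \<bar>indicator B (X 0 \<omega>) :: real\<bar> powr p)" if [measurable]: "B \<in> sets borel" for B
    by (rule integrable_const_bound[where B = 1]) (use p in \<open>auto simp: indicator_def\<close>)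
  have "Int_stable (range (atMost :: real \<Rightarrow> real set))"
    by (auto simp: Int_stable_def)
  moreover have "range atMost \<subseteq> Pow (UNIV :: real set)" by simp
  moreover have "B \<in> sigma_sets UNIV (range atMost)"
    using B by (simp add: borel_eq_atMost)
  ultimately show ?thesis
  proof (induction rule: sigma_sets_induct_disjoint)
    case (basic A)
    then show ?case using qconv_atMost[OF p] by auto
  next
    case empty
    then show ?case using qconv_const[of p 0] by (simp add: fun_eq_iff[symmetric] indicator_def)
  next
    case (compl A)
    then have "A \<in> sets borel" by (simp add: borel_eq_atMost)
    with compl have "qconv p (\<lambda>x. 1 + (- 1) * indicator A x)"
      by (intro qconv_add[OF p] qconv_const qconv_cmult) auto
    also have "(\<lambda>x. 1 + (- 1) * indicator A x) = (indicator (UNIV - A) :: real \<Rightarrow> real)"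
      by (auto simp: indicator_def)
    finally show ?case .
  next
    case (union A)
    have A [measurable]: "A i \<in> sets borel" for i
      using union by (auto simp: borel_eq_atMost)
    show ?case
    proof (rule qconv_dominated_limit[OF p, where u = "\<lambda>k x. \<Sum>i<k. indicator (A i) x"])
      show "qconv p (\<lambda>x. \<Sum>i<k. indicator (A i) x)" for k
        using union A by (intro qconv_sum[OF p]) auto
      have eq: "(\<Sum>i<k. indicator (A i) x) = (indicator (\<Union>i<k. A i) x :: real)" for k x
        using union by (intro indicator_UN_disjoint[symmetric]) (auto simp: disjoint_family_on_def)
      show "(\<lambda>k. \<Sum>i<k. indicator (A i) x :: real) \<longlonglongrightarrow> indicator (\<Union>i. A i) x" for x
        unfolding eq by (rule LIMSEQ_indicator_UN)
      show "\<bar>\<Sum>i<k. indicator (A i) x :: real\<bar> \<le> 2 * \<bar>indicator (\<Union>i. A i) x\<bar>" for k x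
        unfolding eq by (auto simp: indicator_def)
      show "integrable M (\<lambda>\<omega>. \<bar>indicator (\<Union>i. A i) (X 0 \<omega>) :: real\<bar> powr p)"
        by (rule int) measurable
    qed measurable
  qed
qed

theorem empirical_quantile_Lp:
  assumes p: "0 < p" and g [measurable]: "g \<in> borel_measurable borel"
    and int: "integrable M (\<lambda>\<omega>. \<bar>g (X 0 \<omega>)\<bar> powr p)"
  shows "AE \<omega> in M. (\<lambda>n. qdist p g n \<omega>) \<longlonglongrightarrow> 0"
proof -
  \<comment> \<open>Taken relative to the point 0, the simple approximants obey |u k x| \<le> 2 * |g
    x|; this is the origin of the factor 2 in \<open>qconv_dominated_limit\<close>.\<close>
  from borel_measurable_implies_sequence_metric[OF g, of 0]
  obtain u where simple: "\<And>k. simple_function borel (u k)" and lim: "\<And>x. (\<lambda>k. u k x) \<longlonglongrightarrow> g x"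
    and bound: "\<And>k x. \<bar>u k x\<bar> \<le> 2 * \<bar>g x\<bar>"
    by auto
  have "qconv p (u k)" for k
  proof -
    have sets: "u k -` {y} \<in> sets borel" for y
      using simple_functionD(2)[OF simple, of k "{y}"] by simp
    have "qconv p (\<lambda>x. \<Sum>y\<in>range (u k). y * indicator (u k -` {y}) x)"
      by (intro qconv_sum[OF p] qconv_cmult qconv_indicator[OF p] borel_measurable_times borel_measurable_indicator sets) auto
    moreover have "(\<Sum>y\<in>range (u k). y * indicator (u k -` {y}) x) = u k x" for x
    proof -
      have "(\<Sum>y\<in>range (u k). y * indicator (u k -` {y}) x)
          = (\<Sum>y\<in>u k ` space borel. indicator (u k -` {y} \<inter> space borel) x *\<^sub>R y)"
        by (simp add: mult.commute)
      also have "\<dots> = u k x"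
        by (rule simple_function_indicator_representation_banach[OF simple, symmetric]) simp
      finally show ?thesis .
    qed
    ultimately show ?thesis by simp
  qed
  then have "qconv p g"
    by (rule qconv_dominated_limit[OF p g borel_measurable_simple_function[OF simple] _ lim bound int])
  then show ?thesis by (simp add: qconv_def)
qed

end

subsection \<open>L-statistics\<close>

text \<open>Transfers identities known almost surely at every X j to the order statistics.\<close>

lemma order_stat_mem:
  assumes "1 \<le> i" "i \<le> n"
  shows "\<exists>j<n. order_stat X n i \<omega> = X j \<omega>"
proof -
  have "sort (map (\<lambda>j. X j \<omega>) [0..<n]) ! (i - 1) \<in> set (sort (map (\<lambda>j. X j \<omega>) [0..<n]))"
    using assms by (intro nth_mem) auto
  then show ?thesis by (auto simp: order_stat_def)
qed

lemma step_coef_cell: "0 < t \<Longrightarrow> step_coef c n t = c n (cell n t)"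
  by (simp add: step_coef_def cell_def)

text \<open>The endpoints form a null set; this moves the centring to the open interval, where
  \<open>qf_le_iff\<close> is available.\<close>

lemma set_integral_unit_interval:
  fixes f :: "real \<Rightarrow> real"
  shows "(LINT t:{0..1}|lborel. f t) = (LINT t|unif. f t)"
proof -
  have "(LINT t:{0..1}|lborel. f t) = (LINT t:{0<..<1}|lborel. f t)"
    unfolding set_lebesgue_integral_def
    by (rule integral_discrete_difference[where X = "{0, 1}"]) (auto simp: indicator_def)
  also have "\<dots> = (LINT t|unif. f t)"
    unfolding set_lebesgue_integral_def by (subst integral_restrict_space) auto
  finally show ?thesis .
qed

lemma ennreal_between_0:
  fixes r :: ennreal
  assumes "0 < r"
  obtains s where "0 < s" "ennreal s < r"
proof (cases r)
  case (real x)
  with assms show ?thesis by (intro that[of "x / 2"]) (auto simp: ennreal_less_iff)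
next
  case top
  then show ?thesis by (intro that[of 1]) auto
qed

lemma nn_integral_cell_Cq:
  assumes "0 < n"
  shows "(\<integral>\<^sup>+t. ennreal (\<bar>c n (cell n t)\<bar> powr q) \<partial>unif) = ennreal (Cq c n q)"
proof -
  have "(\<integral>\<^sup>+t. ennreal (\<bar>c n (cell n t)\<bar> powr q) \<partial>unif)
      = (\<Sum>i=1..n. ennreal (\<bar>c n i\<bar> powr q)) * ennreal (1 / real n)"
    by (rule nn_integral_cell[OF assms])
  also have "\<dots> = ennreal ((\<Sum>i=1..n. \<bar>c n i\<bar> powr q) * (1 / real n))"
    by (subst sum_ennreal) (simp_all add: ennreal_mult' sum_nonneg del: times_divide_eq_right)
  finally show ?thesis by (simp only: Cq_def mult.commute)
qed

text \<open>Young's inequality without its constants. The two powers agree at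
  \<open>b = a powr (q - 1)\<close>: below this threshold the product is at most
  \<open>a powr q\<close>, above it a is at most \<open>b powr (p - 1)\<close>.\<close>

lemma mult_le_powr_add:
  fixes a b p q :: real
  assumes p: "1 < p" and q: "q = p / (p - 1)" and "0 \<le> a" "0 \<le> b"
  shows "a * b \<le> a powr q + b powr p"
proof (cases "a = 0 \<or> b = 0")
  case False
  with assms have a: "0 < a" and b: "0 < b" by auto
  have q1: "q - 1 = 1 / (p - 1)" using p by (simp add: q field_simps)
  show ?thesis
  proof (cases "b \<le> a powr (q - 1)")
    case True
    then have "a * b \<le> a * a powr (q - 1)" using a by simp
    also have "\<dots> = a powr q" using a by (simp add: powr_mult_base)
    finally show ?thesis by (simp add: add_increasing2)
  next
    case False
    then have "(a powr (q - 1)) powr (p - 1) \<le> b powr (p - 1)"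
      using p by (intro powr_mono2) auto
    moreover have "(a powr (q - 1)) powr (p - 1) = a"
      using p a by (simp add: powr_powr q1)
    ultimately have "a * b \<le> b powr (p - 1) * b" using b by simp
    also have "\<dots> = b powr p" using b by (simp add: powr_mult_base mult.commute)
    finally show ?thesis by (simp add: add_increasing)
  qed
qed auto

section \<open>Coefficients against Lp distances\<close>

context
  fixes c :: "nat \<Rightarrow> nat \<Rightarrow> real" and p :: real
  assumes p: "1 \<le> p"
    and bounded: "if p = 1 then (\<exists>B. \<forall>n\<ge>1. Cinf c n \<le> B) else (\<exists>B. \<forall>n\<ge>1. Cq c n (p / (p - 1)) \<le> B)"
begin

text \<open>What matters is the order of the quantifiers: K depends on s but on neither n nor d. At
  most a share s is charged to the coefficients, and the rest vanishes together with the Lp norm of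
  d.\<close>

lemma coefficient_bound:
  assumes s: "0 < s"
  shows "\<exists>K. \<forall>n\<ge>1. \<forall>d\<in>borel_measurable unif. (\<integral>\<^sup>+t. ennreal (\<bar>c n (cell n t)\<bar> * \<bar>d t\<bar>) \<partial>unif)
    \<le> ennreal s + ennreal K * (\<integral>\<^sup>+t. ennreal (\<bar>d t\<bar> powr p) \<partial>unif)"
proof (cases "p = 1")
  case True
  with bounded obtain B where B: "\<And>n. 1 \<le> n \<Longrightarrow> Cinf c n \<le> B" by auto
  show ?thesis
  proof (intro exI allI impI ballI)
    fix n :: nat and d :: "real \<Rightarrow> real" assume n: "1 \<le> n" and [measurable]: "d \<in> borel_measurable unif"
    have "(\<integral>\<^sup>+t. ennreal (\<bar>c n (cell n t)\<bar> * \<bar>d t\<bar>) \<partial>unif) \<le> (\<integral>\<^sup>+t. ennreal B * ennreal (\<bar>d t\<bar> powr p) \<partial>unif)"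
    proof (rule nn_integral_mono)
      fix t assume "t \<in> space unif"
      then have "cell n t \<in> {1..n}" using n by (intro cell_range) auto
      then have "\<bar>c n (cell n t)\<bar> \<le> Cinf c n" unfolding Cinf_def by (intro Max_ge) auto
      with B[OF n] have le: "\<bar>c n (cell n t)\<bar> \<le> B" by simp
      then have "0 \<le> B" by (rule order_trans[OF abs_ge_zero])
      with le show "ennreal (\<bar>c n (cell n t)\<bar> * \<bar>d t\<bar>) \<le> ennreal B * ennreal (\<bar>d t\<bar> powr p)"
        by (auto simp: True ennreal_mult[symmetric] intro!: ennreal_leI mult_right_mono)
    qed
    also have "\<dots> = ennreal B * (\<integral>\<^sup>+t. ennreal (\<bar>d t\<bar> powr p) \<partial>unif)"
      by (rule nn_integral_cmult) measurable
    finally show "(\<integral>\<^sup>+t. ennreal (\<bar>c n (cell n t)\<bar> * \<bar>d t\<bar>) \<partial>unif)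
        \<le> ennreal s + ennreal B * (\<integral>\<^sup>+t. ennreal (\<bar>d t\<bar> powr p) \<partial>unif)"
      by (rule order_trans) simp
  qed
next
  case False
  with p have p1: "1 < p" by simp
  define q where "q = p / (p - 1)"
  have q: "0 < q" using p1 by (simp add: q_def)
  from False bounded obtain B where B: "\<And>n. 1 \<le> n \<Longrightarrow> Cq c n q \<le> B" by (auto simp: q_def)
  \<comment> \<open>Scaling the coefficient by \<eta> and d by its reciprocal leaves the product
    unchanged; this \<eta> brings the coefficient term down to s. The summand 1 keeps the
    denominator positive.\<close>
  define \<eta> where "\<eta> = (s / (\<bar>B\<bar> + 1)) powr (1 / q)"
  have \<eta>: "0 < \<eta>" using s by (simp add: \<eta>_def)
  have \<eta>q: "\<eta> powr q = s / (\<bar>B\<bar> + 1)" using s q by (simp add: \<eta>_def powr_powr)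
  show ?thesis
  proof (intro exI allI impI ballI)
    fix n :: nat and d :: "real \<Rightarrow> real" assume n: "1 \<le> n" and [measurable]: "d \<in> borel_measurable unif"
    have "(\<integral>\<^sup>+t. ennreal (\<bar>c n (cell n t)\<bar> * \<bar>d t\<bar>) \<partial>unif)
        \<le> (\<integral>\<^sup>+t. ennreal (\<eta> powr q) * ennreal (\<bar>c n (cell n t)\<bar> powr q)
              + ennreal ((1 / \<eta>) powr p) * ennreal (\<bar>d t\<bar> powr p) \<partial>unif)"
    proof (rule nn_integral_mono)
      fix t
      have "\<bar>c n (cell n t)\<bar> * \<bar>d t\<bar> = (\<eta> * \<bar>c n (cell n t)\<bar>) * (1 / \<eta> * \<bar>d t\<bar>)"
        using \<eta> by simp
      also have "\<dots> \<le> (\<eta> * \<bar>c n (cell n t)\<bar>) powr q + (1 / \<eta> * \<bar>d t\<bar>) powr p"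
        using \<eta> by (intro mult_le_powr_add[OF p1 q_def]) auto
      also have "\<dots> = \<eta> powr q * \<bar>c n (cell n t)\<bar> powr q + (1 / \<eta>) powr p * \<bar>d t\<bar> powr p"
        using \<eta> by (simp only: powr_mult abs_ge_zero less_imp_le zero_le_divide_1_iff)
      finally show "ennreal (\<bar>c n (cell n t)\<bar> * \<bar>d t\<bar>) \<le> ennreal (\<eta> powr q) * ennreal (\<bar>c n (cell n t)\<bar> powr q)
              + ennreal ((1 / \<eta>) powr p) * ennreal (\<bar>d t\<bar> powr p)"
        by (simp only: ennreal_mult[symmetric] ennreal_plus[symmetric] powr_ge_zero mult_nonneg_nonneg ennreal_leI)
    qed
    also have "\<dots> = ennreal (\<eta> powr q) * ennreal (Cq c n q)
        + ennreal ((1 / \<eta>) powr p) * (\<integral>\<^sup>+t. ennreal (\<bar>d t\<bar> powr p) \<partial>unif)"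
      using n by (simp add: nn_integral_add nn_integral_cmult nn_integral_cell_Cq)
    also have "ennreal (\<eta> powr q) * ennreal (Cq c n q) \<le> ennreal s"
    proof -
      have "\<eta> powr q * Cq c n q \<le> s / (\<bar>B\<bar> + 1) * (\<bar>B\<bar> + 1)"
        unfolding \<eta>q using s B[OF n] by (intro mult_left_mono) auto
      then have "\<eta> powr q * Cq c n q \<le> s" by simp
      then show ?thesis by (simp only: ennreal_mult'[symmetric] powr_ge_zero ennreal_leI)
    qed
    finally show "(\<integral>\<^sup>+t. ennreal (\<bar>c n (cell n t)\<bar> * \<bar>d t\<bar>) \<partial>unif)
        \<le> ennreal s + ennreal ((1 / \<eta>) powr p) * (\<integral>\<^sup>+t. ennreal (\<bar>d t\<bar> powr p) \<partial>unif)"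
      by (simp add: add_right_mono)
  qed
qed

end

section \<open>Reduction to a weighted distance, and the Lp case\<close>

context stationary_ergodic
begin

text \<open>Dominates the distance of the L-statistic from its centring; under either condition the
  task becomes to send it to 0.\<close>

definition weighted_dist :: "(nat \<Rightarrow> nat \<Rightarrow> real) \<Rightarrow> (real \<Rightarrow> real) \<Rightarrow> nat \<Rightarrow> 'a \<Rightarrow> ennreal" where
  "weighted_dist c h n \<omega> = (\<integral>\<^sup>+t. ennreal (\<bar>c n (cell n t)\<bar> * \<bar>h (emp_qf n \<omega> t) - h (qf t)\<bar>) \<partial>unif)"

lemma L_stat_diff_bound:
  fixes h :: "real \<Rightarrow> real"
  assumes n: "0 < n" and int: "integrable unif (\<lambda>t. h (qf t))"
  shows "ennreal \<bar>L_stat c h X n \<omega> - (LINT t:{0..1}|lborel. step_coef c n t * h (qf t))\<bar> \<le> weighted_dist c h n \<omega>"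
proof -
  let ?c = "\<lambda>t. c n (cell n t)"
  have [measurable]: "?c \<in> borel_measurable unif"
    by (rule measurable_compose[OF measurable_cell]) simp
  have [measurable]: "(\<lambda>t. h (qf t)) \<in> borel_measurable unif" using int by simp
  have 1: "integrable unif (\<lambda>t. ?c t * h (emp_qf n \<omega> t))"
    by (rule integrable_cell[OF n])
  \<comment> \<open>Here n is fixed, so the largest of its finitely many coefficients serves as a
    bound.\<close>
  have 2: "integrable unif (\<lambda>t. ?c t * h (qf t))"
  proof (rule Bochner_Integration.integrable_bound[OF integrable_mult_right[OF int, of "Max ((\<lambda>i. \<bar>c n i\<bar>) ` {1..n})"]])
    show "AE t in unif. norm (?c t * h (qf t)) \<le> norm (Max ((\<lambda>i. \<bar>c n i\<bar>) ` {1..n}) * h (qf t))"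
    proof (rule AE_I2)
      fix t assume "t \<in> space unif"
      then have "cell n t \<in> {1..n}" using n by (intro cell_range) auto
      then have "\<bar>?c t\<bar> \<le> Max ((\<lambda>i. \<bar>c n i\<bar>) ` {1..n})" by (intro Max_ge) auto
      then have "\<bar>?c t\<bar> \<le> \<bar>Max ((\<lambda>i. \<bar>c n i\<bar>) ` {1..n})\<bar>" by linarith
      then show "norm (?c t * h (qf t)) \<le> norm (Max ((\<lambda>i. \<bar>c n i\<bar>) ` {1..n}) * h (qf t))"
        unfolding real_norm_def abs_mult by (rule mult_right_mono) simp
    qed
  qed measurable
  have "L_stat c h X n \<omega> = (LINT t|unif. ?c t * h (emp_qf n \<omega> t))"
    using integral_cell[OF n, of "\<lambda>i. c n i * h (order_stat X n i \<omega>)"] by (simp add: L_stat_def)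
  moreover have "(LINT t:{0..1}|lborel. step_coef c n t * h (qf t)) = (LINT t|unif. ?c t * h (qf t))"
    unfolding set_integral_unit_interval
    by (rule Bochner_Integration.integral_cong) (auto simp: step_coef_cell)
  ultimately have "L_stat c h X n \<omega> - (LINT t:{0..1}|lborel. step_coef c n t * h (qf t))
      = (LINT t|unif. ?c t * h (emp_qf n \<omega> t) - ?c t * h (qf t))"
    using 1 2 by simp
  moreover have "ennreal (norm (LINT t|unif. ?c t * h (emp_qf n \<omega> t) - ?c t * h (qf t)))
      \<le> (\<integral>\<^sup>+t. ennreal (norm (?c t * h (emp_qf n \<omega> t) - ?c t * h (qf t))) \<partial>unif)"
    by (rule integral_norm_bound_ennreal) (use 1 2 in simp)
  ultimately show ?thesis
    unfolding weighted_dist_def by (simp add: right_diff_distrib[symmetric] abs_mult)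
qed

lemma L_stat_tendsto:
  fixes h :: "real \<Rightarrow> real"
  assumes int: "integrable unif (\<lambda>t. h (qf t))" and lim: "(\<lambda>n. weighted_dist c h n \<omega>) \<longlonglongrightarrow> 0"
  shows "(\<lambda>n. L_stat c h X n \<omega> - (LINT t:{0..1}|lborel. step_coef c n t * h (qf t))) \<longlonglongrightarrow> 0"
    (is "?d \<longlonglongrightarrow> 0")
proof -
  have "eventually (\<lambda>n. ennreal \<bar>?d n\<bar> \<le> weighted_dist c h n \<omega>) sequentially"
    using eventually_gt_at_top[of 0] by eventually_elim (rule L_stat_diff_bound[OF _ int])
  then have "(\<lambda>n. ennreal \<bar>?d n\<bar>) \<longlonglongrightarrow> ennreal 0"
    using tendsto_0_le_ennreal[OF _ lim] by simp
  then have "(\<lambda>n. \<bar>?d n\<bar>) \<longlonglongrightarrow> 0"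
    by (subst (asm) tendsto_ennreal_iff) auto
  then show ?thesis by (simp only: tendsto_rabs_zero_iff)
qed

lemma weighted_dist_tendsto_Lp:
  assumes p: "1 \<le> p"
    and bounded: "if p = 1 then (\<exists>B. \<forall>n\<ge>1. Cinf c n \<le> B) else (\<exists>B. \<forall>n\<ge>1. Cq c n (p / (p - 1)) \<le> B)"
    and [measurable]: "h \<in> borel_measurable borel" and lim: "(\<lambda>n. qdist p h n \<omega>) \<longlonglongrightarrow> 0"
  shows "(\<lambda>n. weighted_dist c h n \<omega>) \<longlonglongrightarrow> 0"
proof (rule order_tendstoI)
  fix r :: ennreal assume "0 < r"
  then obtain s where s: "0 < s" "ennreal s < r" by (rule ennreal_between_0)
  \<comment> \<open>s is fixed before K: K may grow as s shrinks, but it does not change with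
    n.\<close>
  from coefficient_bound[OF p bounded s(1)] obtain K where
    K: "\<And>n d. 1 \<le> n \<Longrightarrow> d \<in> borel_measurable unif \<Longrightarrow> (\<integral>\<^sup>+t. ennreal (\<bar>c n (cell n t)\<bar> * \<bar>d t\<bar>) \<partial>unif)
    \<le> ennreal s + ennreal K * (\<integral>\<^sup>+t. ennreal (\<bar>d t\<bar> powr p) \<partial>unif)"
    by blast
  have "(\<lambda>n. ennreal s + ennreal K * qdist p h n \<omega>) \<longlonglongrightarrow> ennreal s + ennreal K * 0"
    by (intro tendsto_add tendsto_const ennreal_tendsto_cmult lim) simp
  with s(2) have "eventually (\<lambda>n. ennreal s + ennreal K * qdist p h n \<omega> < r) sequentially"
    by (intro order_tendstoD(2)) auto
  then show "eventually (\<lambda>n. weighted_dist c h n \<omega> < r) sequentially"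
    using eventually_ge_at_top[of 1]
  proof eventually_elim
    case (elim n)
    have "(\<lambda>t. h (emp_qf n \<omega> t) - h (qf t)) \<in> borel_measurable unif" by measurable
    from K[OF elim(2) this] elim(1) show ?case
      unfolding weighted_dist_def qdist_def by (rule le_less_trans)
  qed
qed simp

lemma integrable_qf:
  fixes h :: "real \<Rightarrow> real"
  assumes [measurable]: "h \<in> borel_measurable borel"
  shows "integrable unif (\<lambda>t. h (qf t)) \<longleftrightarrow> integrable M (\<lambda>\<omega>. h (X 0 \<omega>))"
proof -
  have "integrable unif (\<lambda>t. h (qf t)) \<longleftrightarrow> integrable law h"
    unfolding distr_qf[symmetric] by (rule integrable_distr_eq[symmetric]) measurable
  also have "\<dots> \<longleftrightarrow> integrable M (\<lambda>\<omega>. h (X 0 \<omega>))"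
    by (rule integrable_distr_eq) measurable
  finally show ?thesis .
qed

theorem L_stat_tendsto_Lp:
  assumes p: "1 \<le> p"
    and bounded: "if p = 1 then (\<exists>B. \<forall>n\<ge>1. Cinf c n \<le> B) else (\<exists>B. \<forall>n\<ge>1. Cq c n (p / (p - 1)) \<le> B)"
    and h [measurable]: "h \<in> borel_measurable borel"
    and fin: "(\<integral>\<^sup>+ \<omega>. ennreal (\<bar>h (X 0 \<omega>)\<bar> powr p) \<partial>M) < \<infinity>"
  shows "AE \<omega> in M. (\<lambda>n. L_stat c h X n \<omega> - (LINT t:{0..1}|lborel. step_coef c n t * h (qf t))) \<longlonglongrightarrow> 0"
proof -
  have intp: "integrable M (\<lambda>\<omega>. \<bar>h (X 0 \<omega>)\<bar> powr p)"
    using fin by (intro integrableI_nonneg) auto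
  have "integrable M (\<lambda>\<omega>. h (X 0 \<omega>))"
  proof (rule Bochner_Integration.integrable_bound)
    show "integrable M (\<lambda>\<omega>. 1 + \<bar>h (X 0 \<omega>)\<bar> powr p)" using intp by simp
    \<comment> \<open>A finite p-th moment yields a finite first moment, which is needed to write
      the difference from the centring as one integral.\<close>
    have "\<bar>x\<bar> \<le> 1 + \<bar>x\<bar> powr p" for x :: real
    proof (cases "\<bar>x\<bar> \<le> 1")
      case False
      then have "\<bar>x\<bar> powr 1 \<le> \<bar>x\<bar> powr p" using p by (intro powr_mono) auto
      then show ?thesis using False by simp
    qed (simp add: add_increasing2)
    then show "AE \<omega> in M. norm (h (X 0 \<omega>)) \<le> norm (1 + \<bar>h (X 0 \<omega>)\<bar> powr p)"
      by (intro AE_I2) (simp add: add_nonneg_nonneg)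
  qed measurable
  then have int: "integrable unif (\<lambda>t. h (qf t))" by (simp only: integrable_qf[OF h])
  have "0 < p" using p by simp
  from empirical_quantile_Lp[OF this h intp] show ?thesis
  proof eventually_elim
    case (elim \<omega>)
    from L_stat_tendsto[OF int weighted_dist_tendsto_Lp[OF p bounded h elim]] show ?case .
  qed
qed

section \<open>Jumps of the distribution function and Glivenko-Cantelli\<close>

abbreviation F_left :: "real \<Rightarrow> real" where
  "F_left x \<equiv> measure law {..<x}"

lemma F_measure: "F x = measure law {..x}"
  by (simp add: F_cdf cdf_def)

lemma F_left_le_F: "F_left x \<le> F x"
  unfolding F_measure by (intro law.finite_measure_mono) auto

lemma F_le_F_left: "x < y \<Longrightarrow> F x \<le> F_left y"
  unfolding F_measure by (intro law.finite_measure_mono) auto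

lemma F_left_mono: "x \<le> y \<Longrightarrow> F_left x \<le> F_left y"
  by (intro law.finite_measure_mono) auto

lemma le_F_qf: "t \<in> {0<..<1} \<Longrightarrow> t \<le> F (qf t)"
  using qf_le_iff[of t "qf t"] by simp

text \<open>To the left of \<open>qf t\<close> the distribution function is at most t, and the bound
  survives in the left limit. With \<open>le_F_qf\<close>, t lies between F(x-) and F(x) for x =
  \<open>qf t\<close>.\<close>

lemma F_left_qf_le:
  assumes t: "t \<in> {0<..<1}"
  shows "F_left (qf t) \<le> t"
proof (rule tendsto_upperbound)
  show "(F \<longlongrightarrow> F_left (qf t)) (at_left (qf t))"
    unfolding F_cdf by (rule law.cdf_at_left)
  have "F x \<le> t" if "x < qf t" for x
    using qf_le_iff[OF t, of x] that by simp
  then show "eventually (\<lambda>x. F x \<le> t) (at_left (qf t))"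
    by (auto simp: eventually_at_filter)
qed simp

text \<open>An atom of the law is a flat stretch of the quantile function.\<close>

lemma qf_eqI:
  assumes "s \<in> {0<..<1}" "F_left x < s" "s \<le> F x"
  shows "qf s = x"
proof (rule antisym)
  show "qf s \<le> x" using assms by (simp add: qf_le_iff)
  show "x \<le> qf s"
  proof (rule ccontr)
    assume "\<not> x \<le> qf s"
    then have "F (qf s) \<le> F_left x" by (intro F_le_F_left) simp
    with le_F_qf[OF assms(1)] assms(2) show False by simp
  qed
qed

text \<open>Serves to reach the ends of a jump: the left end is outside the scope of
  \<open>qf_eqI\<close>, and an end may be 0 or 1, where G is known only by continuity.\<close>

lemma continuous_eq_closed_interval:
  fixes G :: "real \<Rightarrow> real"
  assumes "a < b" "continuous_on {a..b} G" "\<And>s. s \<in> {a<..<b} \<Longrightarrow> G s = y" "s \<in> {a..b}"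
  shows "G s = y"
  using continuous_constant_on_closure[of "{a<..<b}" G y s] assms by simp

lemma F_range: "F x \<in> {0..1}" "F_left x \<in> {0..1}"
  unfolding F_measure by (auto intro: law.prob_le_1)

definition empirical_cdf_left :: "nat \<Rightarrow> 'a \<Rightarrow> real \<Rightarrow> real" where
  "empirical_cdf_left n \<omega> a = real (card {j. j < n \<and> X j \<omega> < a}) / real n"

lemma empirical_cdf_le_left: "x < y \<Longrightarrow> empirical_cdf X n \<omega> x \<le> empirical_cdf_left n \<omega> y"
  unfolding empirical_cdf_def empirical_cdf_left_def
  by (intro divide_right_mono of_nat_mono card_mono) auto

text \<open>The Glivenko--Cantelli grid argument: between an alleged violation and the truth there is room
  for a level j/k, and the quantile at that level contradicts closeness there. Atoms of the law are
  the reason why left limits are tracked separately.\<close>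

lemma emp_qf_near:
  assumes n: "0 < n" and t: "t \<in> {0<..<1}" and e: "0 < e" and k: "1 / real k < e / 2" "0 < k"
    and close: "\<And>j. j \<in> {1..<k} \<Longrightarrow>
      \<bar>empirical_cdf X n \<omega> (qf (real j / real k)) - F (qf (real j / real k))\<bar> < e / 2"
    and close_left: "\<And>j. j \<in> {1..<k} \<Longrightarrow>
      \<bar>empirical_cdf_left n \<omega> (qf (real j / real k)) - F_left (qf (real j / real k))\<bar> < e / 2"
  shows "t - e \<le> F (emp_qf n \<omega> t)" "F_left (emp_qf n \<omega> t) \<le> t + e"
proof -
  define x where "x = emp_qf n \<omega> t"
  have x_iff: "x \<le> a \<longleftrightarrow> t \<le> empirical_cdf X n \<omega> a" for a
    unfolding x_def by (rule emp_qf_le_iff[OF n t])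
  \<comment> \<open>The witness is the first grid level strictly above v.\<close>
  have grid: "\<exists>j\<in>{1..<k}. v < real j / real k \<and> real j / real k \<le> v + 1 / real k"
    if v: "0 \<le> v" "v + 1 / real k < 1" for v
  proof (rule bexI[of _ "nat \<lfloor>real k * v\<rfloor> + 1"])
    let ?j = "nat \<lfloor>real k * v\<rfloor> + 1"
    have j: "real ?j = of_int \<lfloor>real k * v\<rfloor> + 1" using v by simp
    have 1: "real k * v < real ?j" "real ?j \<le> real k * v + 1" unfolding j by linarith+
    then show "v < real ?j / real k \<and> real ?j / real k \<le> v + 1 / real k"
      using k(2) by (simp add: field_simps)
    have "real k * v + 1 < real k" using v(2) k(2) by (simp add: field_simps)
    with 1(2) have "real ?j < real k" by linarith
    then show "?j \<in> {1..<k}" by auto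
  qed
  show "t - e \<le> F x"
  proof (rule ccontr)
    assume less: "\<not> t - e \<le> F x"
    \<comment> \<open>The level u falls above F x and below t - e/2. The former puts x to the left
      of \<open>qf u\<close>, so the empirical left value there is at least t; closeness and
      \<open>F_left_qf_le\<close> keep it below u + e/2 < t. F itself may jump past u at
      \<open>qf u\<close>.\<close>
    have "F x + 1 / real k < 1" using less t e k by auto
    with grid[of "F x"] F_range[of x] obtain j where j: "j \<in> {1..<k}"
      and u: "F x < real j / real k" "real j / real k \<le> F x + 1 / real k" by auto
    define u where "u = real j / real k"
    have u01: "u \<in> {0<..<1}" using j by (auto simp: u_def)
    have "x < qf u" using qf_le_iff[OF u01, of x] u by (simp add: u_def)
    then have "t \<le> empirical_cdf_left n \<omega> (qf u)"
      using x_iff[of x] empirical_cdf_le_left[of x "qf u" n \<omega>] by simp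
    with close_left[OF j] F_left_qf_le[OF u01] u k less show False
      unfolding u_def by linarith
  qed
  show "F_left x \<le> t + e"
  proof (rule ccontr)
    assume less: "\<not> F_left x \<le> t + e"
    \<comment> \<open>The offset e/2 pays for the closeness error: u lies between t + e/2 and t + e.
      The upper bound forces \<open>qf u\<close> to the left of x, so the empirical value there is
      below t, while closeness keeps it above u - e/2 > t.\<close>
    have "t + e / 2 + 1 / real k < 1" using less law.prob_le_1[of "{..<x}"] k by linarith
    with grid[of "t + e / 2"] t e obtain j where j: "j \<in> {1..<k}"
      and u: "t + e / 2 < real j / real k" "real j / real k \<le> t + e / 2 + 1 / real k" by auto
    define u where "u = real j / real k"
    have u01: "u \<in> {0<..<1}" using j by (auto simp: u_def)
    have "qf u < x"
    proof (rule ccontr)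
      assume "\<not> qf u < x"
      then have "F_left x \<le> F_left (qf u)" by (intro F_left_mono) simp
      with F_left_qf_le[OF u01] u k less show False unfolding u_def by linarith
    qed
    then have "empirical_cdf X n \<omega> (qf u) < t" using x_iff[of "qf u"] by simp
    with close[OF j] le_F_qf[OF u01] u show False unfolding u_def by linarith
  qed
qed

section \<open>Continuous H\<close>

context
  fixes G h :: "real \<Rightarrow> real"
  assumes G: "continuous_on {0..1} G" and Gh: "\<And>t. t \<in> {0<..<1} \<Longrightarrow> G t = h (qf t)"
    and h [measurable]: "h \<in> borel_measurable borel"
begin

text \<open>The law is the image of the uniform law under \<open>qf\<close>, so it suffices to treat
  x = \<open>qf u\<close>. There F x is u itself, or the right end of an interval on which
  \<open>qf\<close> is constantly x; continuity then carries the value to F x, even if F x =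
  1.\<close>

lemma AE_G_F: "AE \<omega> in M. G (F (X i \<omega>)) = h (X i \<omega>)"
proof -
  \<comment> \<open>Clamping to [0,1] turns G, whose continuity is given only there, into a Borel
    function on the line.\<close>
  define G' where "G' t = G (max 0 (min 1 t))" for t
  have "continuous_on UNIV G'"
    unfolding G'_def by (rule continuous_on_compose2[OF G]) (auto intro!: continuous_intros)
  then have [measurable]: "G' \<in> borel_measurable borel" by (rule borel_measurable_continuous_onI)
  have [measurable]: "F \<in> borel_measurable borel" unfolding F_cdf by (rule law.measurable_C)
  have G': "G' (F x) = G (F x)" for x using F_range[of x] by (simp add: G'_def)
  have "AE u in unif. G (F (qf u)) = h (qf u)"
  proof (rule AE_I2)
    fix u assume "u \<in> space unif"
    then have u: "u \<in> {0<..<1}" by simp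
    show "G (F (qf u)) = h (qf u)"
    proof (cases "u < F (qf u)")
      case True
      show ?thesis
      proof (rule continuous_eq_closed_interval[where G = G, OF True])
        show "continuous_on {u..F (qf u)} G"
          using u F_range[of "qf u"] by (intro continuous_on_subset[OF G]) auto
        fix s assume s: "s \<in> {u<..<F (qf u)}"
        with u F_range[of "qf u"] have s1: "s \<in> {0<..<1}" by auto
        have "qf s = qf u"
          using F_left_qf_le[OF u] s by (intro qf_eqI s1) auto
        then show "G s = h (qf u)" using Gh[OF s1] by simp
      qed (use True in auto)
    next
      case False
      with le_F_qf[OF u] have "F (qf u) = u" by simp
      with Gh[OF u] show ?thesis by simp
    qed
  qed
  then have "AE u in unif. G' (F (qf u)) = h (qf u)" by (simp only: G')
  moreover have "{x \<in> space borel. G' (F x) = h x} \<in> sets borel" by measurable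
  ultimately have "AE x in distr unif borel qf. G' (F x) = h x"
    by (simp only: AE_distr_iff[OF measurable_qf])
  then have law: "AE x in law. G (F x) = h x" by (simp only: distr_qf G')
  \<comment> \<open>Stationarity for segments of length 1 says that all marginals agree; the
    identity is wanted at every sample point.\<close>
  have same: "distr M borel (X i) = law"
  proof -
    have eq: "distr M (PiM {..<1::nat} (\<lambda>_. borel)) (\<lambda>\<omega>. \<lambda>j\<in>{..<1}. X (j + k) \<omega>)
      = distr M (PiM {..<1::nat} (\<lambda>_. borel)) (\<lambda>\<omega>. \<lambda>j\<in>{..<1}. X j \<omega>)" for k
      using stationary by (simp only: strictly_stationary_def)
    have comp: "distr (distr M (PiM {..<1::nat} (\<lambda>_. borel)) (\<lambda>\<omega>. \<lambda>j\<in>{..<1}. X (j + k) \<omega>)) borel (\<lambda>y. y 0)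
        = distr M borel (X k)" for k
      by (subst distr_distr) (auto simp: comp_def)
    show ?thesis using comp[of i] comp[of 0] eq[of i] by simp
  qed
  show ?thesis
    using AE_distrD[OF measurable_X law[folded same]] .
qed

text \<open>At an atom the quantile function is constant inside the jump and continuity adds the
  ends. Without a jump s can only be F x, and the assumption on x gives the value.\<close>

lemma G_eq_h:
  assumes x: "G (F x) = h x" and s: "F_left x \<le> s" "s \<le> F x"
  shows "G s = h x"
proof (cases "F_left x < F x")
  case True
  show ?thesis
  proof (rule continuous_eq_closed_interval[where G = G, OF True])
    show "continuous_on {F_left x..F x} G"
      using F_range[of x] by (intro continuous_on_subset[OF G]) auto
    fix s assume s: "s \<in> {F_left x<..<F x}"
    with F_range[of x] le_less_trans[OF measure_nonneg[of law "{..<x}"], of s]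
    have s1: "s \<in> {0<..<1}" by auto
    with s show "G s = h x" using Gh[OF s1] qf_eqI[OF s1, of x] by auto
  qed (use s in auto)
next
  case False
  with s have "s = F x" by linarith
  with x show ?thesis by simp
qed

lemma AE_emp_qf_uniform:
  "AE \<omega> in M. \<forall>r>0. eventually (\<lambda>n. \<forall>t\<in>{0<..<1}. \<bar>h (emp_qf n \<omega> t) - h (qf t)\<bar> \<le> r) sequentially"
proof -
  have "AE \<omega> in M. (\<lambda>n. empirical_cdf_left n \<omega> y) \<longlonglongrightarrow> F_left y" for y
    using slln_sets[of "{..<y}"] by (simp add: empirical_cdf_left_def)
  \<comment> \<open>The grid size k will depend on r, so the levels of all grids share one null
    set.\<close>
  then have "AE \<omega> in M. \<forall>k j::nat. (\<lambda>n. empirical_cdf_left n \<omega> (qf (real j / real k))) \<longlonglongrightarrow> F_left (qf (real j / real k))"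
    by (simp only: AE_all_countable) simp
  moreover have "AE \<omega> in M. \<forall>k j::nat. (\<lambda>n. empirical_cdf X n \<omega> (qf (real j / real k))) \<longlonglongrightarrow> F (qf (real j / real k))"
    using empirical_cdf_tendsto by (simp only: AE_all_countable) simp
  moreover have "AE \<omega> in M. \<forall>i. G (F (X i \<omega>)) = h (X i \<omega>)"
    using AE_G_F by (simp only: AE_all_countable) simp
  ultimately show ?thesis
  proof eventually_elim
    case (elim \<omega>)
    show ?case
    proof (intro allI impI)
      fix r :: real assume "0 < r"
      from compact_uniformly_continuous[OF G compact_Icc] this obtain d where d: "0 < d"
        and unif: "\<And>s t. s \<in> {0..1} \<Longrightarrow> t \<in> {0..1} \<Longrightarrow> \<bar>s - t\<bar> < d \<Longrightarrow> \<bar>G s - G t\<bar> < r"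
        unfolding uniformly_continuous_on_def dist_real_def by blast
      \<comment> \<open>Half of d, because the distance of s from t obeys only a weak inequality
        while uniform continuity asks for a strict one.\<close>
      define e where "e = d / 2"
      have e: "0 < e" "e < d" using d by (auto simp: e_def)
      have "0 < e / 2" using e by simp
      from nat_approx_posE[OF this] obtain m where m: "1 / real (Suc m) < e / 2" .
      define k where "k = Suc m"
      have close: "eventually (\<lambda>n. \<forall>j\<in>{1..<k}.
          \<bar>empirical_cdf X n \<omega> (qf (real j / real k)) - F (qf (real j / real k))\<bar> < e / 2) sequentially"
        using tendstoD[OF elim(2)[rule_format] \<open>0 < e / 2\<close>]
        by (intro eventually_ball_finite) (simp_all add: dist_real_def)
      have close_left: "eventually (\<lambda>n. \<forall>j\<in>{1..<k}.
          \<bar>empirical_cdf_left n \<omega> (qf (real j / real k)) - F_left (qf (real j / real k))\<bar> < e / 2) sequentially"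
        using tendstoD[OF elim(1)[rule_format] \<open>0 < e / 2\<close>]
        by (intro eventually_ball_finite) (simp_all add: dist_real_def)
      from close close_left eventually_gt_at_top[of 0]
      show "eventually (\<lambda>n. \<forall>t\<in>{0<..<1}. \<bar>h (emp_qf n \<omega> t) - h (qf t)\<bar> \<le> r) sequentially"
      proof (eventually_elim, intro ballI)
        case (elim n)
        fix t :: real assume t: "t \<in> {0<..<1}"
        let ?x = "emp_qf n \<omega> t"
        have near: "t - e \<le> F ?x" "F_left ?x \<le> t + e"
          using emp_qf_near[OF elim(3) t e(1), of k \<omega>] elim m by (auto simp: k_def)
        obtain j where "?x = X j \<omega>"
          using order_stat_mem[of "cell n t" n X \<omega>] cell_range[OF elim(3) t] by auto
        with \<open>\<forall>i. G (F (X i \<omega>)) = h (X i \<omega>)\<close> have GF: "G (F ?x) = h ?x" by simp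
        \<comment> \<open>s is t clamped to the jump interval of the sample point; by
          \<open>near\<close> this moves t by at most e.\<close>
        define s where "s = max (F_left ?x) (min (F ?x) t)"
        have s: "F_left ?x \<le> s" "s \<le> F ?x" "\<bar>s - t\<bar> \<le> e"
          using near F_left_le_F[of ?x] e by (auto simp: s_def)
        have "s \<in> {0..1}"
          using order_trans[OF measure_nonneg s(1)] s(2) F_range(1)[of ?x] by auto
        then have "\<bar>G s - G t\<bar> < r"
          using s t e by (intro unif) auto
        then show "\<bar>h ?x - h (qf t)\<bar> \<le> r"
          using G_eq_h[OF GF s(1,2)] Gh[OF t] by simp
      qed
    qed
  qed
qed

theorem L_stat_tendsto_continuous:
  assumes bounded: "\<exists>B. \<forall>n\<ge>1. Cq c n 1 \<le> B"
  shows "AE \<omega> in M. (\<lambda>n. L_stat c h X n \<omega> - (LINT t:{0..1}|lborel. step_coef c n t * h (qf t))) \<longlonglongrightarrow> 0"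
proof -
  obtain B where B: "\<And>n. 1 \<le> n \<Longrightarrow> Cq c n 1 \<le> B" using bounded by blast
  have "bounded (G ` {0..1})"
    by (intro compact_imp_bounded compact_continuous_image G) simp
  then obtain b where b: "\<And>t. t \<in> {0..1} \<Longrightarrow> \<bar>G t\<bar> \<le> b"
    unfolding bounded_iff real_norm_def by blast
  \<comment> \<open>Integrability comes from boundedness of G on a compact interval, in place of a
    moment assumption.\<close>
  have int: "integrable unif (\<lambda>t. h (qf t))"
  proof (rule unif.integrable_const_bound)
    show "AE t in unif. norm (h (qf t)) \<le> b"
      using b Gh by (intro AE_I2) (auto simp flip: Gh)
  qed measurable
  from AE_emp_qf_uniform show ?thesis
  proof eventually_elim
    case (elim \<omega>)
    have "(\<lambda>n. weighted_dist c h n \<omega>) \<longlonglongrightarrow> 0"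
    proof (rule order_tendstoI)
      fix r :: ennreal assume "0 < r"
      then obtain s where s: "0 < s" "ennreal s < r" by (rule ennreal_between_0)
      \<comment> \<open>A uniform bound \<eta> on the difference gets multiplied by the mean
        absolute coefficient, at most B; the product must stay below s.\<close>
      define \<eta> where "\<eta> = s / (\<bar>B\<bar> + 1)"
      have \<eta>: "0 < \<eta>" using s by (simp add: \<eta>_def)
      from elim[rule_format, OF this] eventually_ge_at_top[of 1]
      show "eventually (\<lambda>n. weighted_dist c h n \<omega> < r) sequentially"
      proof eventually_elim
        case (elim n)
        have "weighted_dist c h n \<omega> \<le> (\<integral>\<^sup>+t. ennreal \<eta> * ennreal (\<bar>c n (cell n t)\<bar> powr 1) \<partial>unif)"
          unfolding weighted_dist_def
        proof (rule nn_integral_mono)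
          fix t assume "t \<in> space unif"
          with elim(1) have "\<bar>h (emp_qf n \<omega> t) - h (qf t)\<bar> \<le> \<eta>" by auto
          then have "\<bar>c n (cell n t)\<bar> * \<bar>h (emp_qf n \<omega> t) - h (qf t)\<bar> \<le> \<eta> * \<bar>c n (cell n t)\<bar>"
            by (subst mult.commute) (rule mult_right_mono, simp_all)
          then show "ennreal (\<bar>c n (cell n t)\<bar> * \<bar>h (emp_qf n \<omega> t) - h (qf t)\<bar>)
              \<le> ennreal \<eta> * ennreal (\<bar>c n (cell n t)\<bar> powr 1)"
            using \<eta> by (simp add: ennreal_mult[symmetric] ennreal_leI)
        qed
        also have "\<dots> = ennreal \<eta> * ennreal (Cq c n 1)"
          using elim(2) nn_integral_cell_Cq[of n c 1] by (subst nn_integral_cmult) simp_all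
        also have "\<dots> = ennreal (\<eta> * Cq c n 1)" using \<eta> by (simp add: ennreal_mult')
        also have "\<eta> * Cq c n 1 \<le> s"
        proof -
          have "\<eta> * Cq c n 1 \<le> s / (\<bar>B\<bar> + 1) * (\<bar>B\<bar> + 1)"
            unfolding \<eta>_def using s B[OF elim(2)] by (intro mult_left_mono) auto
          then show ?thesis by simp
        qed
        finally show ?case using s(2) by (meson ennreal_leI le_less_trans order_trans)
      qed
    qed simp
    with L_stat_tendsto[OF int] show ?case by blast
  qed
qed

end
end

theorem theorem1:
  fixes M :: "'a measure" and X :: "nat \<Rightarrow> 'a \<Rightarrow> real"
    and h :: "real \<Rightarrow> real" and c :: "nat \<Rightarrow> nat \<Rightarrow> real"
  assumes "prob_space M"
    and "\<And>i. X i \<in> borel_measurable M"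
    and "strictly_stationary M X"
    and "ergodic_seq M X"
    and "h \<in> borel_measurable borel"
    and "(\<exists>G. continuous_on {0..1} G \<and>
            (\<forall>t\<in>{0<..<1}. G t = h (quantile (distr_fun M (X 0)) t))) \<and>
          (\<exists>B. \<forall>n\<ge>1. Cq c n 1 \<le> B)
        \<or> (\<exists>p::real. 1 \<le> p \<and>
             (\<integral>\<^sup>+ \<omega>. ennreal (\<bar>h (X 0 \<omega>)\<bar> powr p) \<partial>M) < \<infinity> \<and>
             (if p = 1 then (\<exists>B. \<forall>n\<ge>1. Cinf c n \<le> B)
              else (\<exists>B. \<forall>n\<ge>1. Cq c n (p / (p - 1)) \<le> B)))"
  shows "AE \<omega> in M. (\<lambda>n. L_stat c h X n \<omega>
           - (LINT t:{0..1}|lborel. step_coef c n t * h (quantile (distr_fun M (X 0)) t)))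
           \<longlonglongrightarrow> 0"
proof -
  interpret stationary_ergodic M X
    using assms(1-4) by (simp add: stationary_ergodic_def stationary_ergodic_axioms_def)
  from assms(6) show ?thesis
  proof (elim disjE conjE exE)
    fix G B assume G: "continuous_on {0..1} G" "\<forall>t\<in>{0<..<1}. G t = h (qf t)"
      and B: "\<forall>n\<ge>1. Cq c n 1 \<le> B"
    show ?thesis
      by (rule L_stat_tendsto_continuous[OF G(1) G(2)[rule_format] assms(5)]) (use B in auto)
  next
    fix p assume "1 \<le> p" "(\<integral>\<^sup>+ \<omega>. ennreal (\<bar>h (X 0 \<omega>)\<bar> powr p) \<partial>M) < \<infinity>"
      "if p = 1 then (\<exists>B. \<forall>n\<ge>1. Cinf c n \<le> B) else (\<exists>B. \<forall>n\<ge>1. Cq c n (p / (p - 1)) \<le> B)"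
    then show ?thesis using assms(5) by (intro L_stat_tendsto_Lp)
  qed
qed

end
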